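(* Let $r\geq1$ be an integer. Then for all sufficiently large $n$, $$\mathrm{Spex}_{3}(n, B_{r+1})\subseteq\mathrm{Ex}_{3}(n, B_{r+1}).$$
   Context: All graphs are finite, simple and undirected. The book $B_{r+1}$ is the graph consisting of $r+1$ triangles sharing a common edge (and otherwise disjoint). A graph is $H$-free if it does not contain $H$ as a (not necessarily induced) subgraph. $\mathrm{ex}_3(n,B_{r+1})$ is the maximum number of edges in a non-bipartite $B_{r+1}$-free graph on $n$ vertices, and $\mathrm{Ex}_3(n,B_{r+1})$ is the set of all non-bipartite $B_{r+1}$-free graphs on $n$ vertices with exactly $\mathrm{ex}_3(n,B_{r+1})$ edges. The spectral radius $\rho(G)$ is the largest eigenvalue of the adjacency matrix of $G$, and $\mathrm{Spex}_3(n,B_{r+1})$ is the set of non-bipartite $B_{r+1}$-free graphs on $n$ vertices whose spectral radius is maximum among all non-bipartite $B_{r+1}$-free graphs on $n$ vertices. *)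

theory Defs
  imports "Graph_Theory.Graph_Theory" "Jordan_Normal_Form.Spectral_Radius"
begin

text \<open>
  A finite simple undirected graph is a \<^locale>\<open>pair_graph\<close>: a finite vertex set with a
  finite, irreflexive, symmetric set of arcs, the undirected edge \<open>{u,v}\<close> being represented by
  the two arcs \<open>(u,v)\<close> and \<open>(v,u)\<close>.  Graphs on \<open>n\<close> vertices are taken on the vertex set
  \<open>{0..<n}\<close>; every graph on \<open>n\<close> vertices is isomorphic to one of these, and all notions below
  are invariant under isomorphism.
\<close>

definition graphs_on :: "nat \<Rightarrow> nat pair_pre_digraph set" where
  "graphs_on n = {G. pair_graph G \<and> pverts G = {0..<n}}"

definition num_edges :: "'a pair_pre_digraph \<Rightarrow> nat" where
  "num_edges G = card ((\<lambda>(u, v). {u, v}) ` parcs G)"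

definition bipartite :: "'a pair_pre_digraph \<Rightarrow> bool" where
  "bipartite G \<longleftrightarrow> (\<exists>A B. pverts G = A \<union> B \<and> A \<inter> B = {} \<and>
     (\<forall>(u, v) \<in> parcs G. (u \<in> A \<and> v \<in> B) \<or> (u \<in> B \<and> v \<in> A)))"

text \<open>Subgraphs need not be induced.\<close>

definition free_of :: "'b pair_pre_digraph \<Rightarrow> 'a pair_pre_digraph \<Rightarrow> bool" where
  "free_of H G \<longleftrightarrow> \<not> (\<exists>K :: 'a pair_pre_digraph.
     subgraph (with_proj K) (with_proj G) \<and> digraph_iso (with_proj H) (with_proj K))"

text \<open>\<open>book k\<close> is the book with \<open>k\<close> triangles \<open>{0, 1, i}\<close>, where \<open>2 \<le> i < k + 2\<close>, on the
  common edge \<open>{0, 1}\<close>.\<close>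

definition book :: "nat \<Rightarrow> nat pair_pre_digraph" where
  "book k = (let E = {(0, 1)} \<union> {0, 1} \<times> {2..<k + 2}
             in \<lparr>pverts = {0..<k + 2}, parcs = E \<union> E\<inverse>\<rparr>)"

text \<open>The row and column indices of the matrix are the vertices, so this is meant for graphs
  with vertex set \<open>{0..<n}\<close>.\<close>

definition adjacency_matrix :: "nat pair_pre_digraph \<Rightarrow> real mat" where
  "adjacency_matrix G =
     (let n = card (pverts G) in mat n n (\<lambda>(i, j). if (i, j) \<in> parcs G then 1 else 0))"

text \<open>The largest eigenvalue.  The real spectrum of the (symmetric) adjacency matrix is finite,
  and it is nonempty as soon as the graph has a vertex.\<close>

definition graph_spectral_radius :: "nat pair_pre_digraph \<Rightarrow> real" where
  "graph_spectral_radius G = Max (spectrum (adjacency_matrix G))"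

definition nonbipartite_free :: "nat \<Rightarrow> nat pair_pre_digraph \<Rightarrow> nat pair_pre_digraph set" where
  "nonbipartite_free n H = {G \<in> graphs_on n. \<not> bipartite G \<and> free_of H G}"

text \<open>For \<open>H = book (r + 1)\<close> with \<open>r \<ge> 1\<close>, the maximum is over a finite set, which is nonempty
  for \<open>n \<ge> 3\<close>; for smaller \<open>n\<close> the value is irrelevant.\<close>

definition ex3 :: "nat \<Rightarrow> nat pair_pre_digraph \<Rightarrow> nat" where
  "ex3 n H = Max (num_edges ` nonbipartite_free n H)"

definition Ex3 :: "nat \<Rightarrow> nat pair_pre_digraph \<Rightarrow> nat pair_pre_digraph set" where
  "Ex3 n H = {G \<in> nonbipartite_free n H. num_edges G = ex3 n H}"

definition Spex3 :: "nat \<Rightarrow> nat pair_pre_digraph \<Rightarrow> nat pair_pre_digraph set" where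
  "Spex3 n H = {G \<in> nonbipartite_free n H.
     \<forall>G' \<in> nonbipartite_free n H. graph_spectral_radius G' \<le> graph_spectral_radius G}"

end

theory Submission
  imports Defs "HOL-Analysis.Function_Topology"
begin

text \<open>
  Write \<open>F\<close> for \<open>\<lfloor>(n - 1)\<^sup>2 / 4\<rfloor>\<close> and \<open>e\<close> for the number of edges. For large \<open>n\<close> the extremal number turns
  out to be \<open>F + 2r\<close>, attained by a balanced complete bipartite graph on \<open>n - 1\<close> vertices together
  with one further vertex \<open>x\<close> joined to \<open>r\<close> vertices of each class. The proof bounds the edges of all
  non-bipartite book-free graphs by \<open>F + 2r\<close> and shows that a graph of maximum spectral radius
  attains this bound. Book-freeness means that adjacent vertices have at most \<open>r\<close> common neighbours.

  Stability (\<open>ex_near_bipartition\<close>, \<open>bipartite_after_deleting_vertex\<close>). If \<open>e \<ge> n\<^sup>2/4 - O(n)\<close>, some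
  edge \<open>uv\<close> has degree sum \<open>n - O(1)\<close>; its two neighbourhoods are almost disjoint, induce bounded
  degree, and miss only \<open>O(n)\<close> cross pairs, so up to boundedly many exceptional vertices the graph
  is bipartite. If moreover \<open>e \<ge> n\<^sup>2/4 - n/2 - O(1)\<close>, charge each exceptional vertex with its
  deficit against full adjacency to the opposite class. The deficits add up to at most about \<open>n/2\<close>,
  while the two ends of an edge inside a class have total deficit about \<open>n/2\<close>, because they share at
  most \<open>r\<close> neighbours. Hence a vertex \<open>x\<close> of largest deficit meets every such edge, and \<open>G - x\<close> is
  bipartite with classes \<open>A\<close> and \<open>B\<close>.

  Edges (\<open>edges_le\<close>). If \<open>x\<close> has \<open>s\<close> neighbours in \<open>A\<close> and \<open>t\<close> in \<open>B\<close>, then \<open>e = |A||B| - m + s + t\<close>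
  with \<open>m\<close> the number of missing cross pairs. Each neighbour of \<open>x\<close> in \<open>A\<close> misses at least \<open>t - r\<close>
  neighbours of \<open>x\<close> in \<open>B\<close>, so \<open>m\<close> absorbs everything beyond \<open>2r\<close>.

  Spectral radius. Counting walks of length two from a vertex where the Perron vector is largest
  gives \<open>2\<rho>\<^sup>2 \<le> 2e + (number of arcs inside its neighbourhood)\<close> (\<open>rho_square_le\<close>). One vertex joined to
  a balanced complete bipartite graph shows \<open>\<rho>\<^sup>2 \<ge> F\<close> for a maximizer, so stability applies, first
  with a linear error and then, since a near-bipartition makes the neighbourhood sparse, with a
  bounded one (\<open>rho_square_le_refined\<close>). Thus a maximizer has the structure above, and adding up the
  eigenvalue equation over the two classes yields \<open>rho_square_identity\<close>: each missing pair lowers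
  \<open>\<rho>\<^sup>2 - |A||B|\<close> by a constant, while the edges at \<open>x\<close> raise it by only \<open>O((s + t)\<^sup>2 / n)\<close>. So
  \<open>\<rho>\<^sup>2 \<ge> F\<close> forces \<open>m = 0\<close> and \<open>|A||B| = F\<close> (\<open>extremal_structure\<close>). Finally \<open>s = t = r\<close>, because
  otherwise another edge at \<open>x\<close> could be added, and this strictly increases \<open>\<rho>\<close>.
\<close>

section \<open>The spectral radius as the maximum of a quadratic form\<close>

definition bilin :: "nat \<Rightarrow> (nat \<Rightarrow> nat \<Rightarrow> real) \<Rightarrow> (nat \<Rightarrow> real) \<Rightarrow> (nat \<Rightarrow> real) \<Rightarrow> real" where
  "bilin n M f g = (\<Sum>i<n. \<Sum>j<n. f i * M i j * g j)"

lemma bilin_add_scaled: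
  assumes "\<And>i j. M i j = M j i"
  shows "bilin n M (\<lambda>i. f i + t * g i) (\<lambda>i. f i + t * g i)
    = bilin n M f f + 2 * t * bilin n M g f + t\<^sup>2 * bilin n M g g"
proof -
  have "bilin n M f g = bilin n M g f"
    unfolding bilin_def by (subst sum.swap) (use assms in \<open>simp add: ac_simps\<close>)
  moreover have "bilin n M (\<lambda>i. f i + t * g i) (\<lambda>i. f i + t * g i)
    = bilin n M f f + t * bilin n M f g + t * bilin n M g f + t\<^sup>2 * bilin n M g g"
    by (simp add: bilin_def sum.distrib sum_distrib_left algebra_simps power2_eq_square)
  ultimately show ?thesis by simp
qed

text \<open>
  The unit sphere of the first \<open>n\<close> coordinates is compact as a closed subset of a product of compact
  intervals; the coordinates from \<open>n\<close> on are pinned to \<open>0\<close> so that the product topology on functions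
  can be used for every \<open>n\<close> at once.
\<close>

lemma ex_max_on_sphere:
  assumes "n \<ge> 1"
  shows "\<exists>v. (\<Sum>i<n. (v i)\<^sup>2) = 1 \<and> (\<forall>f. (\<Sum>i<n. (f i)\<^sup>2) = 1 \<longrightarrow> bilin n M f f \<le> bilin n M v v)"
proof -
  define C where "C = PiE UNIV (\<lambda>i. if i < n then {-1..1::real} else {0})"
  define S where "S = {v. (\<Sum>i<n. (v i)\<^sup>2) = (1::real)}"
  have "compactin (product_topology (\<lambda>i. euclidean) (UNIV :: nat set)) C"
    unfolding C_def compactin_PiE by (auto simp: compact_Icc)
  then have "compact C"
    by (simp only: euclidean_product_topology compactin_euclidean_iff)
  moreover have "closed S"
    unfolding S_def by (intro closed_Collect_eq continuous_intros) auto
  ultimately have cpt: "compact (C \<inter> S)" by (rule compact_Int_closed)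
  have "(\<Sum>i<n. ((if i = 0 then 1 else 0)::real)\<^sup>2) = 1"
    using assms by (simp add: if_distrib[of "\<lambda>x. x\<^sup>2"] cong: if_cong)
  then have "(\<lambda>i. if i = 0 then 1 else 0) \<in> C \<inter> S"
    using assms by (auto simp: C_def S_def)
  then have ne: "C \<inter> S \<noteq> {}" by blast
  have "continuous_on (C \<inter> S) (\<lambda>f. bilin n M f f)"
    unfolding bilin_def
    by (intro continuous_intros continuous_on_subset[OF continuous_on_product_coordinates]) auto
  from continuous_attains_sup[OF cpt ne this]
  obtain v where v: "v \<in> C \<inter> S" "\<And>f. f \<in> C \<inter> S \<Longrightarrow> bilin n M f f \<le> bilin n M v v" by blast
  have "bilin n M f f \<le> bilin n M v v" if f: "(\<Sum>i<n. (f i)\<^sup>2) = 1" for f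
  proof -
    let ?g = "\<lambda>i. if i < n then f i else 0"
    have "\<bar>f i\<bar> \<le> 1" if "i < n" for i
    proof -
      have "(f i)\<^sup>2 \<le> (\<Sum>i<n. (f i)\<^sup>2)" by (rule member_le_sum) (use that in auto)
      then show ?thesis using f by (simp add: abs_square_le_1)
    qed
    then have "?g \<in> C \<inter> S" using f by (auto simp: C_def S_def abs_le_iff minus_le_iff)
    from v(2)[OF this] show ?thesis by (simp add: bilin_def)
  qed
  then show ?thesis using v(1) by (auto simp: S_def)
qed

text \<open>
  A maximizer of the quadratic form on the sphere stays one when its entries are replaced by their
  absolute values, as the matrix is nonnegative. It is an eigenvector by the first-order condition
  in each coordinate direction.
\<close>

lemma perron_rayleigh:
  assumes n: "n \<ge> 1" and sym: "\<And>i j. M i j = M j i" and pos: "\<And>i j. M i j \<ge> 0"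
  shows "\<exists>\<rho> z. (\<forall>i. z i \<ge> 0) \<and> (\<Sum>i<n. (z i)\<^sup>2) = 1
    \<and> (\<forall>i<n. (\<Sum>j<n. M i j * z j) = \<rho> * z i)
    \<and> (\<forall>f. bilin n M f f \<le> \<rho> * (\<Sum>i<n. (f i)\<^sup>2))"
proof -
  obtain v where v: "(\<Sum>i<n. (v i)\<^sup>2) = 1"
    "\<And>f. (\<Sum>i<n. (f i)\<^sup>2) = 1 \<Longrightarrow> bilin n M f f \<le> bilin n M v v"
    using ex_max_on_sphere[OF n, of M] by blast
  define \<rho> where "\<rho> = bilin n M v v"
  define z where "z i = \<bar>v i\<bar>" for i
  have ray: "bilin n M f f \<le> \<rho> * (\<Sum>i<n. (f i)\<^sup>2)" for f
  proof (cases "(\<Sum>i<n. (f i)\<^sup>2) = 0")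
    case True
    then have "\<forall>i<n. f i = 0" by (subst (asm) sum_nonneg_eq_0_iff) auto
    then have "bilin n M f f = 0" by (simp add: bilin_def)
    then show ?thesis using True by simp
  next
    case False
    define s where "s = (\<Sum>i<n. (f i)\<^sup>2)"
    have s: "s > 0" using False by (simp add: s_def sum_nonneg less_le)
    define g where "g i = f i / sqrt s" for i
    have "(\<Sum>i<n. (g i)\<^sup>2) = s / s"
      using s by (simp add: g_def power_divide flip: sum_divide_distrib s_def)
    then have "bilin n M g g \<le> \<rho>" using v(2) s by (simp add: \<rho>_def)
    moreover have "bilin n M g g = bilin n M f f / s"
      using s by (simp add: bilin_def g_def sum_divide_distrib)
    ultimately show ?thesis using s by (simp add: divide_le_eq flip: s_def)
  qed
  have z1: "(\<Sum>i<n. (z i)\<^sup>2) = 1" using v(1) by (simp add: z_def)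
  have "\<rho> \<le> bilin n M z z"
    unfolding \<rho>_def bilin_def
  proof (intro sum_mono)
    fix i j
    have "v i * v j \<le> z i * z j" unfolding z_def by (metis abs_ge_self abs_mult)
    then show "v i * M i j * v j \<le> z i * M i j * z j"
      using mult_left_mono[OF _ pos[of i j], of "v i * v j" "z i * z j"] by (simp add: ac_simps)
  qed
  then have zq: "bilin n M z z = \<rho>" using ray[of z] z1 by simp
  have "(\<Sum>j<n. M i j * z j) = \<rho> * z i" if i: "i < n" for i
  proof -
    define e where "e j = (if j = i then 1 else 0 :: real)" for j
    define c where "c = (\<Sum>j<n. M i j * z j) - \<rho> * z i"
    have be: "bilin n M e g = (\<Sum>j<n. M i j * g j)" for g
    proof -
      have "bilin n M e g = (\<Sum>k<n. if k = i then (\<Sum>j<n. M i j * g j) else 0)"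
        unfolding bilin_def by (intro sum.cong) (auto simp: e_def)
      then show ?thesis using i by simp
    qed
    have key: "2 * t * c \<le> t\<^sup>2 * (\<rho> - M i i)" for t
    proof -
      have "bilin n M e e = M i i" using i by (simp add: be) (simp add: e_def if_distrib cong: if_cong)
      then have "\<rho> + 2 * t * (\<Sum>j<n. M i j * z j) + t\<^sup>2 * M i i
        \<le> \<rho> * (\<Sum>j<n. (z j + t * e j)\<^sup>2)"
        using ray[of "\<lambda>j. z j + t * e j"] by (simp add: bilin_add_scaled[OF sym] zq be)
      also have "(\<Sum>j<n. (z j + t * e j)\<^sup>2) = (\<Sum>j<n. (z j)\<^sup>2) + 2 * t * (\<Sum>j<n. z j * e j) + t\<^sup>2 * (\<Sum>j<n. (e j)\<^sup>2)"
        by (simp add: power2_sum sum.distrib sum_distrib_left algebra_simps power_mult_distrib)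
      also have "(\<Sum>j<n. z j * e j) = z i" using i by (simp add: e_def if_distrib cong: if_cong)
      also have "(\<Sum>j<n. (e j)\<^sup>2) = 1" using i by (simp add: e_def if_distrib[of "\<lambda>x. x\<^sup>2"] cong: if_cong)
      finally show ?thesis using z1 by (simp add: c_def algebra_simps)
    qed
    \<comment> \<open>The linear term dominates the quadratic one for small \<open>t\<close>; \<open>t = c / k\<close> is small enough.\<close>
    define k where "k = \<bar>\<rho> - M i i\<bar> + 1"
    have "2 * (c / k) * c \<le> (c / k)\<^sup>2 * (\<rho> - M i i)" by (rule key)
    also have "\<dots> \<le> (c / k)\<^sup>2 * k" by (intro mult_left_mono) (auto simp: k_def)
    also have "\<dots> = (c / k) * c" by (simp add: k_def power2_eq_square)
    finally have "c * c / k \<le> 0" by simp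
    moreover have "k > 0" by (simp add: k_def)
    ultimately have "c * c \<le> 0" by (simp add: divide_le_0_iff)
    then have "c = 0" by (metis mult_eq_0_iff order_antisym zero_le_square)
    then show ?thesis by (simp add: c_def)
  qed
  then show ?thesis
    using ray z1 by (intro exI[of _ \<rho>] exI[of _ z]) (auto simp: z_def)
qed

text \<open>
  The maximum of the form is an eigenvalue, and pairing any real eigenvector with itself shows that
  no eigenvalue exceeds it. So it is the largest element of the spectrum, and the Rayleigh bound and
  a nonnegative eigenvector are available for \<^const>\<open>graph_spectral_radius\<close>.
\<close>

lemma graph_spectral_radius_props:
  assumes G: "G \<in> graphs_on n" and n: "n \<ge> 1"
  defines "M \<equiv> \<lambda>i j. if (i, j) \<in> parcs G then 1 else 0 :: real"
  shows "\<exists>z. (\<forall>i. z i \<ge> 0) \<and> (\<Sum>i<n. (z i)\<^sup>2) = 1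
      \<and> (\<forall>i<n. (\<Sum>j<n. M i j * z j) = graph_spectral_radius G * z i)"
    and "bilin n M f f \<le> graph_spectral_radius G * (\<Sum>i<n. (f i)\<^sup>2)"
proof -
  interpret pair_graph G using G by (simp add: graphs_on_def)
  have V: "pverts G = {0..<n}" using G by (simp add: graphs_on_def)
  have sym: "M i j = M j i" for i j
    using arcs_symmetric by (auto simp: M_def)
  have nonneg: "M i j \<ge> 0" for i j by (simp add: M_def)
  let ?A = "adjacency_matrix G"
  have A: "?A \<in> carrier_mat n n" by (simp add: adjacency_matrix_def V Let_def)
  have mv: "(?A *\<^sub>v v) $ i = (\<Sum>j<n. M i j * (v $ j))"
    if "v \<in> carrier_vec n" "i < n" for v i
    using that by (simp add: adjacency_matrix_def V Let_def M_def scalar_prod_def lessThan_atLeast0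
        cong: if_cong)
  obtain \<rho> z where *: "\<And>i. z i \<ge> 0" "(\<Sum>i<n. (z i)\<^sup>2) = 1"
    "\<And>i. i < n \<Longrightarrow> (\<Sum>j<n. M i j * z j) = \<rho> * z i"
    "\<And>f. bilin n M f f \<le> \<rho> * (\<Sum>i<n. (f i)\<^sup>2)"
    using perron_rayleigh[OF n, of M, OF sym nonneg] by blast
  have "eigenvector ?A (vec n z) \<rho>"
    unfolding eigenvector_def
  proof (intro conjI)
    show "vec n z \<in> carrier_vec (dim_row ?A)" using A by simp
    show "vec n z \<noteq> 0\<^sub>v (dim_row ?A)"
    proof
      assume "vec n z = 0\<^sub>v (dim_row ?A)"
      then have "vec n z $ i = 0" if "i < n" for i using that A by simp
      then have "(\<Sum>i<n. (z i)\<^sup>2) = 0" by simp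
      then show False using *(2) by simp
    qed
    show "?A *\<^sub>v vec n z = \<rho> \<cdot>\<^sub>v vec n z"
    proof (rule eq_vecI)
      fix i assume "i < dim_vec (\<rho> \<cdot>\<^sub>v vec n z)"
      then have i: "i < n" by simp
      then have "(\<Sum>j<n. M i j * (vec n z $ j)) = (\<Sum>j<n. M i j * z j)" by simp
      then show "(?A *\<^sub>v vec n z) $ i = (\<rho> \<cdot>\<^sub>v vec n z) $ i"
        using i *(3)[OF i] by (subst mv) auto
    qed (use A in simp)
  qed
  then have mem: "\<rho> \<in> spectrum ?A" by (auto simp: spectrum_def eigenvalue_def)
  have le: "\<mu> \<le> \<rho>" if mu: "\<mu> \<in> spectrum ?A" for \<mu>
  proof -
    obtain w where w: "eigenvector ?A w \<mu>" using mu by (auto simp: spectrum_def eigenvalue_def)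
    then have wc: "w \<in> carrier_vec n" and w0: "w \<noteq> 0\<^sub>v n" and ew: "?A *\<^sub>v w = \<mu> \<cdot>\<^sub>v w"
      using A by (auto simp: eigenvector_def)
    define f where "f i = w $ i" for i
    have ef: "(\<Sum>j<n. M i j * f j) = \<mu> * f i" if "i < n" for i
      using mv[OF wc that] that wc by (simp add: ew f_def)
    have "bilin n M f f = (\<Sum>i<n. f i * (\<Sum>j<n. M i j * f j))"
      by (simp add: bilin_def sum_distrib_left mult.assoc)
    also have "\<dots> = (\<Sum>i<n. f i * (\<mu> * f i))"
      by (intro sum.cong refl) (use ef in simp)
    also have "\<dots> = \<mu> * (\<Sum>i<n. (f i)\<^sup>2)"
      by (simp add: sum_distrib_left power2_eq_square ac_simps)
    finally have "\<mu> * (\<Sum>i<n. (f i)\<^sup>2) \<le> \<rho> * (\<Sum>i<n. (f i)\<^sup>2)" using *(4)[of f] by simp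
    moreover have "(\<Sum>i<n. (f i)\<^sup>2) > 0"
    proof -
      obtain i where "i < n" "w $ i \<noteq> 0" using w0 wc by (metis eq_vecI carrier_vecD index_zero_vec)
      then show ?thesis by (intro sum_pos2[of _ i]) (auto simp: f_def)
    qed
    ultimately show ?thesis by simp
  qed
  have "graph_spectral_radius G = \<rho>"
    unfolding graph_spectral_radius_def
    by (intro Max_eqI card_finite_spectrum[OF A] mem le)
  then show "\<exists>z. (\<forall>i. z i \<ge> 0) \<and> (\<Sum>i<n. (z i)\<^sup>2) = 1
      \<and> (\<forall>i<n. (\<Sum>j<n. M i j * z j) = graph_spectral_radius G * z i)"
    and "bilin n M f f \<le> graph_spectral_radius G * (\<Sum>i<n. (f i)\<^sup>2)"
    using * by auto
qed

section \<open>Graphs as neighbourhood functions\<close>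

lemma card_Int_eq_sum:
  assumes "finite Y"
  shows "card (A \<inter> Y) = (\<Sum>y\<in>Y. if y \<in> A then 1 else 0)"
  using assms by (simp add: sum.If_cases Int_commute)

lemma card_add_card_Diff:
  assumes "finite X"
  shows "card (Y \<inter> X) + card (X - Y) = card X"
proof -
  have "X = (Y \<inter> X) \<union> (X - Y)" "(Y \<inter> X) \<inter> (X - Y) = {}" by auto
  then show ?thesis using assms by (metis card_Un_disjoint finite_Un)
qed

lemma sum_square_le:
  fixes f :: "'a \<Rightarrow> real"
  assumes "finite V"
  shows "(\<Sum>x\<in>V. f x)\<^sup>2 \<le> real (card V) * (\<Sum>x\<in>V. (f x)\<^sup>2)"
proof -
  have "0 \<le> (\<Sum>x\<in>V. \<Sum>y\<in>V. (f x - f y)\<^sup>2)" by (intro sum_nonneg) auto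
  also have "\<dots> = (\<Sum>x\<in>V. \<Sum>y\<in>V. (f x)\<^sup>2 + (f y)\<^sup>2 - 2 * (f x * f y))"
    by (simp add: power2_diff algebra_simps)
  also have "\<dots> = 2 * (real (card V) * (\<Sum>x\<in>V. (f x)\<^sup>2)) - 2 * (\<Sum>x\<in>V. f x)\<^sup>2"
    by (simp add: sum.distrib sum_subtractf power2_eq_square sum_product flip: sum_distrib_left)
  finally show ?thesis by simp
qed

text \<open>
  The combinatorial part works with neighbourhoods \<open>N u\<close> only. As \<open>N\<close> is symmetric with values
  inside \<open>V\<close>, it is empty outside \<open>V\<close>.
\<close>

locale simple_graph =
  fixes V :: "'a set" and N :: "'a \<Rightarrow> 'a set"
  assumes finV: "finite V" and N_sub: "N u \<subseteq> V"
    and N_sym: "v \<in> N u \<Longrightarrow> u \<in> N v" and N_irr: "u \<notin> N u"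
begin

text \<open>
  The degree sum, that is, twice the number of edges.
\<close>

abbreviation D :: nat where "D \<equiv> \<Sum>u\<in>V. card (N u)"

definition indep :: "'a set \<Rightarrow> bool" where
  "indep A \<longleftrightarrow> (\<forall>u\<in>A. N u \<inter> A = {})"

definition bipartition :: "'a set \<Rightarrow> 'a set \<Rightarrow> 'a set \<Rightarrow> bool" where
  "bipartition W A B \<longleftrightarrow> A \<union> B = W \<and> A \<inter> B = {} \<and> indep A \<and> indep B"

lemma fin_N [simp]: "finite (N u)"
  using finV N_sub finite_subset by blast

lemma bipartition_sym: "bipartition W A B \<longleftrightarrow> bipartition W B A"
  by (auto simp: bipartition_def)

lemma double_count:
  assumes "finite X" "finite Y"
  shows "(\<Sum>x\<in>X. card (N x \<inter> Y)) = (\<Sum>y\<in>Y. card (N y \<inter> X))"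
proof -
  have "(\<Sum>x\<in>X. card (N x \<inter> Y)) = (\<Sum>x\<in>X. \<Sum>y\<in>Y. if y \<in> N x then 1 else 0)"
    using assms by (simp add: card_Int_eq_sum)
  also have "\<dots> = (\<Sum>y\<in>Y. \<Sum>x\<in>X. if x \<in> N y then 1 else 0)"
    by (subst sum.swap) (intro sum.cong refl, use N_sym in auto)
  also have "\<dots> = (\<Sum>y\<in>Y. card (N y \<inter> X))"
    using assms by (simp add: card_Int_eq_sum)
  finally show ?thesis .
qed

text \<open>
  Arcs between two different parts occur twice in the degree sum; \<open>R\<close> collects the vertices outside
  both classes.
\<close>

lemma D_split:
  assumes "A \<subseteq> V" "B \<subseteq> V" "A \<inter> B = {}"
  defines "R \<equiv> V - A - B"
  shows "D = (\<Sum>u\<in>A. card (N u \<inter> A)) + (\<Sum>u\<in>B. card (N u \<inter> B)) + 2 * (\<Sum>u\<in>A. card (N u \<inter> B))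
     + 2 * (\<Sum>u\<in>R. card (N u \<inter> (A \<union> B))) + (\<Sum>u\<in>R. card (N u \<inter> R))"
proof -
  have fin: "finite A" "finite B" "finite R"
    using assms finV finite_subset by (auto simp: R_def)
  have V: "V = (A \<union> B) \<union> R" "(A \<union> B) \<inter> R = {}" using assms by (auto simp: R_def)
  have nb: "card (N u) = card (N u \<inter> A) + card (N u \<inter> B) + card (N u \<inter> R)" for u
  proof -
    have eq: "N u = (N u \<inter> A) \<union> (N u \<inter> B) \<union> (N u \<inter> R)" using N_sub V by blast
    have "card ((N u \<inter> A) \<union> (N u \<inter> B) \<union> (N u \<inter> R)) = card ((N u \<inter> A) \<union> (N u \<inter> B)) + card (N u \<inter> R)"
      by (rule card_Un_disjoint) (use fin in \<open>auto simp: R_def\<close>)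
    also have "card ((N u \<inter> A) \<union> (N u \<inter> B)) = card (N u \<inter> A) + card (N u \<inter> B)"
      by (rule card_Un_disjoint) (use fin assms in auto)
    finally show ?thesis using eq by simp
  qed
  have AB: "card (N u \<inter> (A \<union> B)) = card (N u \<inter> A) + card (N u \<inter> B)" for u
    unfolding Int_Un_distrib by (rule card_Un_disjoint) (use fin assms in auto)
  have "D = (\<Sum>u\<in>A. card (N u)) + (\<Sum>u\<in>B. card (N u)) + (\<Sum>u\<in>R. card (N u))"
    unfolding V(1) using fin assms V(2) by (simp add: sum.union_disjoint)
  moreover have "(\<Sum>u\<in>B. card (N u \<inter> A)) = (\<Sum>u\<in>A. card (N u \<inter> B))"
    "(\<Sum>u\<in>A. card (N u \<inter> R)) = (\<Sum>u\<in>R. card (N u \<inter> A))"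
    "(\<Sum>u\<in>B. card (N u \<inter> R)) = (\<Sum>u\<in>R. card (N u \<inter> B))"
    using double_count fin by blast+
  ultimately show ?thesis
    by (simp add: nb AB sum.distrib)
qed

text \<open>
  Averaged over all arcs, the degree sum of the two ends is twice the sum of the squared degrees
  divided by \<open>D\<close>, which is at least \<open>2D/n\<close> by the Cauchy-Schwarz inequality.
\<close>

lemma ex_arc_large_degree_sum:
  assumes "D > 0"
  shows "\<exists>u v. v \<in> N u \<and> card V * (card (N u) + card (N v)) \<ge> 2 * D"
proof (rule ccontr)
  assume "\<not> ?thesis"
  then have less: "card V * (card (N u) + card (N v)) < 2 * D" if "v \<in> N u" for u v
    using that not_le by blast
  \<comment> \<open>A vertex is the head of as many arcs as it has neighbours.\<close>
  have ends: "(\<Sum>u\<in>V. \<Sum>v\<in>N u. card (N v)) = (\<Sum>u\<in>V. (card (N u))\<^sup>2)"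
  proof -
    have eq: "(\<Sum>v\<in>N u. card (N v)) = (\<Sum>v\<in>V. if v \<in> N u then card (N v) else 0)" for u
      using finV N_sub by (simp add: sum.If_cases Int_absorb2 Int_commute[of V])
    have "(\<Sum>u\<in>V. \<Sum>v\<in>N u. card (N v)) = (\<Sum>v\<in>V. \<Sum>u\<in>V. if v \<in> N u then card (N v) else 0)"
      unfolding eq by (rule sum.swap)
    also have "\<dots> = (\<Sum>v\<in>V. \<Sum>u\<in>V. if u \<in> N v then card (N v) else 0)"
      using N_sym by (intro sum.cong refl) auto
    also have "\<dots> = (\<Sum>v\<in>V. (card (N v))\<^sup>2)"
      using finV N_sub by (simp add: sum.If_cases Int_absorb1 power2_eq_square flip: Int_def)
    finally show ?thesis .
  qed
  have "card V * (2 * (\<Sum>u\<in>V. (card (N u))\<^sup>2)) = (\<Sum>u\<in>V. \<Sum>v\<in>N u. card V * (card (N u) + card (N v)))"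
    by (simp add: ends sum.distrib power2_eq_square flip: sum_distrib_left)
  also have "\<dots> < (\<Sum>u\<in>V. \<Sum>v\<in>N u. 2 * D)"
  proof -
    obtain u where u: "u \<in> V" "card (N u) \<noteq> 0" using assms by (metis not_gr0 sum.neutral)
    show ?thesis
    proof (rule sum_strict_mono_ex1[OF finV])
      show "\<forall>x\<in>V. (\<Sum>v\<in>N x. card V * (card (N x) + card (N v))) \<le> (\<Sum>v\<in>N x. 2 * D)"
        by (intro ballI sum_mono less_imp_le less)
      have "N u \<noteq> {}" using u by auto
      then have "(\<Sum>v\<in>N u. card V * (card (N u) + card (N v))) < (\<Sum>v\<in>N u. 2 * D)"
        by (intro sum_strict_mono less) auto
      then show "\<exists>x\<in>V. (\<Sum>v\<in>N x. card V * (card (N x) + card (N v))) < (\<Sum>v\<in>N x. 2 * D)"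
        using u by blast
    qed
  qed
  also have "\<dots> = 2 * D\<^sup>2"
    by (simp add: power2_eq_square flip: sum_distrib_left sum_distrib_right)
  finally have "card V * (\<Sum>u\<in>V. (card (N u))\<^sup>2) < D\<^sup>2" by simp
  then have "real (card V * (\<Sum>u\<in>V. (card (N u))\<^sup>2)) < real (D\<^sup>2)" by (rule of_nat_less_iff[THEN iffD2])
  moreover have "real (D\<^sup>2) \<le> real (card V * (\<Sum>u\<in>V. (card (N u))\<^sup>2))"
    using sum_square_le[OF finV, of "\<lambda>u. real (card (N u))"] by simp
  ultimately show False by simp
qed

section \<open>Stability: dense book-free graphs are nearly bipartite\<close>

definition near_bipartition :: "nat \<Rightarrow> 'a set \<Rightarrow> 'a set \<Rightarrow> bool" where
  "near_bipartition K A B \<longleftrightarrow> A \<subseteq> V \<and> B \<subseteq> V \<and> A \<inter> B = {} \<and> indep A \<and> indep B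
    \<and> card (V - A - B) \<le> K
    \<and> 9 * card V \<le> 20 * card A \<and> 9 * card V \<le> 20 * card B
    \<and> (\<forall>a\<in>A. 50 * card (B - N a) \<le> card V) \<and> (\<forall>b\<in>B. 50 * card (A - N b) \<le> card V)"

lemma near_bipartition_sym: "near_bipartition K A B \<longleftrightarrow> near_bipartition K B A"
proof -
  have "V - A - B = V - B - A" by auto
  then show ?thesis unfolding near_bipartition_def by (auto simp: Int_commute)
qed

end

text \<open>
  For a graph, avoiding the book with \<open>r + 1\<close> triangles means that adjacent vertices have at most
  \<open>r\<close> common neighbours.
\<close>

locale book_free_graph = simple_graph V N
  for V :: "'a set" and N :: "'a \<Rightarrow> 'a set" +
  fixes r :: nat
  assumes codeg: "v \<in> N u \<Longrightarrow> card (N u \<inter> N v) \<le> r"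
begin

lemma nonadjacent_if_common:
  assumes "X \<subseteq> V" "card X > r + card (X - N u) + card (X - N v)"
  shows "v \<notin> N u"
proof
  assume "v \<in> N u"
  have "finite X" using assms finV finite_subset by blast
  have "X \<subseteq> (X - N u) \<union> (X - N v) \<union> (N u \<inter> N v)" by blast
  then have "card X \<le> card ((X - N u) \<union> (X - N v) \<union> (N u \<inter> N v))"
    using \<open>finite X\<close> by (intro card_mono) auto
  also have "\<dots> \<le> card (X - N u) + card (X - N v) + card (N u \<inter> N v)"
    using card_Un_le[of "(X - N u) \<union> (X - N v)" "N u \<inter> N v"] card_Un_le[of "X - N u" "X - N v"] by linarith
  finally show False using codeg[OF \<open>v \<in> N u\<close>] assms by linarith
qed

text \<open>
  The classes are cut out of the neighbourhoods of the ends of an arc \<open>uv\<close> of large degree sum. They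
  induce maximum degree at most \<open>r\<close>, so almost all edges run across, and comparing with \<open>|A||B| \<le> n\<^sup>2/4\<close>
  leaves only \<open>O(n)\<close> missing pairs and nearly equal classes. Discarding the boundedly many vertices
  that miss more than \<open>n/50\<close> of the other class makes the classes independent: two remaining vertices
  of one class have far more than \<open>r\<close> common neighbours.
\<close>

lemma ex_near_bipartition:
  fixes C :: nat
  defines "C1 \<equiv> 2 * C + 2 * r"
  assumes D: "(card V)\<^sup>2 \<le> 2 * D + C * card V" and n: "card V > 4000 * C1 + 10 * r"
  shows "\<exists>A B. near_bipartition (C + r + 100 * C1) A B"
proof -
  define n where "n = card V"
  have nC: "n > 4000 * C1 + 10 * r" using n n_def by simp
  have D': "n * n \<le> 2 * D + C * n" using D by (simp add: n_def power2_eq_square)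
  have "C * n < n * n" using nC by (simp add: C1_def)
  then have "D > 0" using D' by linarith
  then obtain u v where uv: "v \<in> N u" and "n * (card (N u) + card (N v)) \<ge> 2 * D"
    using ex_arc_large_degree_sum unfolding n_def by blast
  then have "n * n \<le> n * (card (N u) + card (N v) + C)" using D' by (simp add: algebra_simps)
  then have deg: "n \<le> card (N u) + card (N v) + C" using nC by simp
  define A where "A = N v - N u"
  define B where "B = N u"
  define R where "R = V - A - B"
  have sub: "A \<subseteq> V" "B \<subseteq> V" "A \<inter> B = {}" using N_sub by (auto simp: A_def B_def)
  have fin: "finite A" "finite B" "finite R" using sub finV finite_subset by (auto simp: R_def)
  have "card (N v) = card A + card (N u \<inter> N v)"
    unfolding A_def using card_add_card_Diff[of "N v" "N u"] by simp
  then have ab: "n \<le> card A + card B + C + r" using deg codeg[OF uv] by (simp add: B_def)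
  have nsum: "n = card A + card B + card R"
  proof -
    have "V = (A \<union> B) \<union> R" "(A \<union> B) \<inter> R = {}" using sub by (auto simp: R_def)
    then show ?thesis unfolding n_def using fin sub by (metis card_Un_disjoint finite_Un)
  qed
  then have R: "card R \<le> C + r" using ab by simp
  have inA: "card (N w \<inter> A) \<le> r" if "w \<in> A" for w
    using that codeg[of w v] by (intro order_trans[OF card_mono codeg[of w v]]) (auto simp: A_def)
  have inB: "card (N w \<inter> B) \<le> r" if "w \<in> B" for w
    using that by (intro order_trans[OF card_mono codeg[of w u]]) (auto simp: B_def)
  define e where "e = (\<Sum>w\<in>A. card (N w \<inter> B))"
  have "(\<Sum>w\<in>A. card (N w \<inter> A)) \<le> r * card A" "(\<Sum>w\<in>B. card (N w \<inter> B)) \<le> r * card B"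
    using sum_bounded_above[of A "\<lambda>w. card (N w \<inter> A)" r] sum_bounded_above[of B "\<lambda>w. card (N w \<inter> B)" r]
      inA inB by (simp_all add: mult.commute)
  moreover have "(\<Sum>w\<in>R. card (N w \<inter> (A \<union> B))) \<le> card R * n" "(\<Sum>w\<in>R. card (N w \<inter> R)) \<le> card R * n"
    using sum_bounded_above[of R "\<lambda>w. card (N w \<inter> (A \<union> B))" n] sum_bounded_above[of R "\<lambda>w. card (N w \<inter> R)" n]
    by (simp_all add: n_def card_mono finV N_sub le_infI1)
  ultimately have "D \<le> r * card A + r * card B + 2 * e + 3 * (card R * n)"
    using D_split[OF sub] by (simp add: e_def R_def)
  also have "\<dots> \<le> r * n + 2 * e + 3 * (C + r) * n"
    using nsum mult_right_mono[OF R, of n] by (simp add: algebra_simps)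
  finally have e1: "n * n \<le> 4 * e + (7 * C + 8 * r) * n" using D' by (simp add: algebra_simps)
  \<comment> \<open>\<open>M\<close> counts the missing cross pairs; it is at most \<open>C1 * n\<close>.\<close>
  define M where "M = (\<Sum>w\<in>A. card (B - N w))"
  have eM: "e + M = card A * card B"
  proof -
    have "card (N w \<inter> B) + card (B - N w) = card B" for w
      using card_add_card_Diff[OF fin(2)] .
    then have "e + M = (\<Sum>w\<in>A. card B)" by (simp only: e_def M_def flip: sum.distrib)
    then show ?thesis by simp
  qed
  have M': "M = (\<Sum>w\<in>B. card (A - N w))"
  proof -
    have "card (N w \<inter> A) + card (A - N w) = card A" for w
      using card_add_card_Diff[OF fin(1)] .
    then have "(\<Sum>w\<in>B. card (N w \<inter> A)) + (\<Sum>w\<in>B. card (A - N w)) = (\<Sum>w\<in>B. card A)"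
      by (simp only: flip: sum.distrib)
    then show ?thesis using eM double_count[OF fin(1,2)] by (simp add: e_def mult.commute)
  qed
  have ABn: "real (card A) + real (card B) \<le> real n" using nsum by linarith
  have e1r: "real n * real n \<le> 4 * real e + (7 * real C + 8 * real r) * real n"
    using of_nat_le_iff[where ?'a = real, THEN iffD2, OF e1] by simp
  have eMr: "real e + real M = real (card A) * real (card B)"
    using arg_cong[OF eM, of real] by simp
  have C1r: "real C1 = 2 * real C + 2 * real r" by (simp add: C1_def)
  have prod: "4 * (real (card A) * real (card B)) = (real (card A) + real (card B))\<^sup>2 - (real (card A) - real (card B))\<^sup>2"
    by (simp add: power2_eq_square algebra_simps)
  have sqn: "(real (card A) + real (card B))\<^sup>2 \<le> real n * real n"
    using ABn unfolding power2_eq_square by (intro mult_mono) auto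
  have C1n: "(7 * real C + 8 * real r) * real n \<le> 4 * real C1 * real n"
    by (intro mult_right_mono) (auto simp: C1r)
  have Mr: "real M \<le> real C1 * real n"
    using e1r eMr prod sqn C1n zero_le_power2[of "real (card A) - real (card B)"] by linarith
  have diff: "(real (card A) - real (card B))\<^sup>2 \<le> 4 * real C1 * real n"
    using e1r eMr prod sqn C1n of_nat_0_le_iff[where ?'a = real, of M] by linarith
  have n4000: "real n > 4000 * real C1 + 10 * real r" 
    using of_nat_less_iff[where ?'a = real, THEN iffD2, OF nC] by simp
  have adiff: "\<bar>real (card A) - real (card B)\<bar> \<le> real n / 20"
  proof -
    have "4 * real C1 * real n \<le> (real n / 400) * real n" by (intro mult_right_mono) (use n4000 in auto)
    also have "\<dots> = (real n / 20)\<^sup>2" by (simp add: power2_eq_square)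
    finally have "(real (card A) - real (card B))\<^sup>2 \<le> (real n / 20)\<^sup>2" using diff by linarith
    then have "\<bar>real (card A) - real (card B)\<bar> \<le> \<bar>real n / 20\<bar>" by (rule abs_le_square_iff[THEN iffD2])
    then show ?thesis by simp
  qed
  have Cr: "real C + real r \<le> real n / 4000" using n4000 by (simp add: C1r)
  have abr: "real n \<le> real (card A) + real (card B) + real C + real r" using ab by linarith
  define WA where "WA = {w \<in> A. 50 * card (B - N w) > n}"
  define WB where "WB = {w \<in> B. 50 * card (A - N w) > n}"
  have WA_sub: "WA \<subseteq> A" and WB_sub: "WB \<subseteq> B" by (auto simp: WA_def WB_def)
  \<comment> \<open>Each discarded vertex accounts for more than \<open>n / 50\<close> missing pairs.\<close>
  have few: "card W \<le> 50 * C1"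
    if "W \<subseteq> X" "finite X" "\<And>w. w \<in> W \<Longrightarrow> 50 * f w > n" "(\<Sum>w\<in>X. f w) = M" for W X and f :: "'a \<Rightarrow> nat"
  proof -
    have "card W * n \<le> (\<Sum>w\<in>W. 50 * f w)"
      using that sum_bounded_below[of W n "\<lambda>w. 50 * f w"] by (simp add: less_imp_le)
    also have "\<dots> \<le> (\<Sum>w\<in>X. 50 * f w)" using that by (intro sum_mono2) auto
    also have "\<dots> = 50 * M" using that by (simp flip: sum_distrib_left)
    finally have "real (card W) * real n \<le> 50 * real M" by (metis of_nat_le_iff of_nat_mult of_nat_numeral)
    also have "\<dots> \<le> (50 * real C1) * real n" using Mr by simp
    finally have "real (card W) \<le> 50 * real C1" using nC by (subst (asm) mult_le_cancel_right_pos) auto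
    then show ?thesis by linarith
  qed
  have WA: "card WA \<le> 50 * C1" by (rule few[of WA A "\<lambda>w. card (B - N w)"]) (auto simp: WA_def fin M_def)
  have WB: "card WB \<le> 50 * C1" by (rule few[of WB B "\<lambda>w. card (A - N w)"]) (auto simp: WB_def fin M')
  define A' where "A' = A - WA"
  define B' where "B' = B - WB"
  have cA: "card A = card A' + card WA" unfolding A'_def
    using card_add_card_Diff[OF fin(1), of WA] WA_sub by (simp add: Int_absorb2)
  have cB: "card B = card B' + card WB" unfolding B'_def
    using card_add_card_Diff[OF fin(2), of WB] WB_sub by (simp add: Int_absorb2)
  have large: "9 * n \<le> 20 * card A'" "9 * n \<le> 20 * card B'"
  proof -
    have "real (card WA) \<le> 50 * real C1" "real (card WB) \<le> 50 * real C1"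
      using WA WB by linarith+
    moreover have "real (card A) = real (card A') + real (card WA)" "real (card B) = real (card B') + real (card WB)"
      using cA cB by auto
    ultimately have "9 * real n \<le> 20 * real (card A') \<and> 9 * real n \<le> 20 * real (card B')"
      using adiff abr Cr n4000 by linarith
    then show "9 * n \<le> 20 * card A'" "9 * n \<le> 20 * card B'" by linarith+
  qed
  have missA: "50 * card (B' - N w) \<le> n" if "w \<in> A'" for w
  proof -
    have "card (B' - N w) \<le> card (B - N w)" by (intro card_mono) (auto simp: B'_def fin)
    then show ?thesis using that by (auto simp: A'_def WA_def)
  qed
  have missB: "50 * card (A' - N w) \<le> n" if "w \<in> B'" for w
  proof -
    have "card (A' - N w) \<le> card (A - N w)" by (intro card_mono) (auto simp: A'_def fin)
    then show ?thesis using that by (auto simp: B'_def WB_def)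
  qed
  have indA: "indep A'"
    unfolding indep_def
  proof (intro ballI equals0I)
    fix u w assume "u \<in> A'" "w \<in> N u \<inter> A'"
    then show False
      using nonadjacent_if_common[of B' u w] missA[of u] missA[of w] large(2) nC sub by (auto simp: B'_def)
  qed
  have indB: "indep B'"
    unfolding indep_def
  proof (intro ballI equals0I)
    fix u w assume "u \<in> B'" "w \<in> N u \<inter> B'"
    then show False
      using nonadjacent_if_common[of A' u w] missB[of u] missB[of w] large(1) nC sub by (auto simp: A'_def)
  qed
  have "V - A' - B' \<subseteq> R \<union> WA \<union> WB" by (auto simp: R_def A'_def B'_def)
  then have "card (V - A' - B') \<le> card (R \<union> WA \<union> WB)"
    by (intro card_mono) (auto simp: fin WA_def WB_def)
  also have "\<dots> \<le> card R + card WA + card WB"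
    using card_Un_le[of "R \<union> WA" WB] card_Un_le[of R WA] by linarith
  also have "\<dots> \<le> C + r + 100 * C1" using R WA WB by linarith
  finally have "near_bipartition (C + r + 100 * C1) A' B'"
    using indA indB large missA missB sub by (auto simp: near_bipartition_def n_def A'_def B'_def)
  then show ?thesis by blast
qed

end

section \<open>Deleting one vertex leaves a bipartite graph\<close>

lemma (in simple_graph) near_bipartitionD:
  assumes "near_bipartition K A B"
  shows "A \<subseteq> V" "B \<subseteq> V" "A \<inter> B = {}" "indep A" "indep B" "card (V - A - B) \<le> K"
    "9 * card V \<le> 20 * card A" "9 * card V \<le> 20 * card B"
    "\<And>a. a \<in> A \<Longrightarrow> 50 * card (B - N a) \<le> card V" "\<And>b. b \<in> B \<Longrightarrow> 50 * card (A - N b) \<le> card V"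
    "finite A" "finite B"
  using assms finV finite_subset by (auto simp: near_bipartition_def)

text \<open>
  A neighbour of \<open>y\<close> in \<open>A\<close> is adjacent to almost all of \<open>B\<close>, and at most \<open>r\<close> of its neighbours are
  neighbours of \<open>y\<close>.
\<close>

lemma (in book_free_graph) few_neighbours_across:
  assumes nb: "near_bipartition K A B" and "N y \<inter> A \<noteq> {}"
  shows "50 * card (N y \<inter> B) \<le> 50 * r + card V"
proof -
  obtain s where s: "s \<in> N y" "s \<in> A" using assms by blast
  have "N y \<inter> B \<subseteq> (N y \<inter> N s) \<union> (B - N s)" by blast
  then have "card (N y \<inter> B) \<le> card ((N y \<inter> N s) \<union> (B - N s))"
    using near_bipartitionD(12)[OF nb] by (intro card_mono) auto
  also have "\<dots> \<le> card (N y \<inter> N s) + card (B - N s)" by (rule card_Un_le)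
  finally show ?thesis using codeg[OF s(1)] near_bipartitionD(9)[OF nb s(2)] by linarith
qed

lemma (in book_free_graph) adjacent_degree_sum:
  assumes "w \<in> N u" "finite X"
  shows "card (N u \<inter> X) + card (N w \<inter> X) \<le> card X + r"
proof -
  have "card (N u \<inter> X) + card (N w \<inter> X) = card ((N u \<inter> X) \<union> (N w \<inter> X)) + card ((N u \<inter> X) \<inter> (N w \<inter> X))"
    using assms by (intro card_Un_Int) auto
  moreover have "card ((N u \<inter> X) \<union> (N w \<inter> X)) \<le> card X" using assms by (intro card_mono) auto
  moreover have "card ((N u \<inter> X) \<inter> (N w \<inter> X)) \<le> card (N u \<inter> N w)" by (intro card_mono) auto
  ultimately show ?thesis using codeg[OF assms(1)] by linarith
qed

text \<open>
  Every exceptional vertex is put on a side: with \<open>A\<close> if it has no neighbour in \<open>A\<close>, with \<open>B\<close>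
  otherwise. Its deficit \<open>df\<close> is the size of the opposite main class minus its degree into the main
  classes. Comparing the edge count with \<open>n\<^sup>2/4\<close> bounds the sum of all deficits by about \<open>n/2\<close>. Both
  obstructions to bipartiteness are expensive, as the main classes have size at least \<open>9n/20\<close>: the
  ends of an edge inside one side have total deficit at least \<open>9n/20 - r\<close>, and a vertex with neighbours
  in both main classes has low degree and deficit about \<open>2n/5\<close> on its own. An obstruction avoiding a vertex \<open>x\<close> of
  maximum deficit would contribute together with \<open>x\<close> at least one and a half times its own cost, or
  twice in the case of a single vertex, which is too much. So deleting \<open>x\<close> removes all obstructions.
\<close>

lemma (in book_free_graph) bipartite_after_deleting_vertex:
  assumes nb: "near_bipartition K A B"
    and D: "(card V)\<^sup>2 \<le> 2 * D + 2 * card V + C"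
    and nonbip: "\<nexists>P Q. bipartition V P Q"
    and n: "card V > 100 * (C + 2 * K\<^sup>2 + r)"
  shows "\<exists>x\<in>V. \<exists>P Q. bipartition (V - {x}) P Q"
proof -
  note nbD = near_bipartitionD[OF nb]
  define L where "L = V - A - B"
  define Lp where "Lp = {y \<in> L. N y \<inter> A = {}}"
  define Lq where "Lq = L - Lp"
  have finL: "finite L" "finite Lp" "finite Lq" using finV by (auto simp: L_def Lp_def Lq_def)
  define h where "h y = real (card (N y \<inter> (A \<union> B)))" for y
  define n where "n = real (card V)"
  define a where "a = real (card A)"
  define b where "b = real (card B)"
  define p where "p = real (card Lp)"
  define q where "q = real (card Lq)"
  define df where "df y = (if y \<in> Lp then b else a) - h y" for y
  have nbig: "n > 100 * (real C + 2 * (real K)\<^sup>2 + real r)"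
    using of_nat_less_iff[where ?'a = real, THEN iffD2, OF n] by (simp add: n_def)
  have "real C \<ge> 0" "2 * (real K)\<^sup>2 \<ge> 0" "real r \<ge> 0" by simp_all
  then have "100 * real r < n \<and> n > 0 \<and> 100 * (real C + 2 * (real K)\<^sup>2) < n"
    using nbig by (intro conjI; simp add: algebra_simps; linarith)
  then have nr: "100 * real r < n" "n > 0" "100 * (real C + 2 * (real K)\<^sup>2) < n" by auto
  have ab: "9 * n \<le> 20 * a" "9 * n \<le> 20 * b"
    using nbD(7,8) unfolding n_def a_def b_def by linarith+
  have hAB: "h y = real (card (N y \<inter> A)) + real (card (N y \<inter> B))" for y
  proof -
    have "card (N y \<inter> (A \<union> B)) = card (N y \<inter> A) + card (N y \<inter> B)"
      unfolding Int_Un_distrib by (rule card_Un_disjoint) (use nbD in auto)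
    then show ?thesis by (simp add: h_def)
  qed
  have low: "h y \<le> n / 25 + 2 * real r" if "N y \<inter> A \<noteq> {}" "N y \<inter> B \<noteq> {}" for y
    using few_neighbours_across[OF nb that(1)]
      few_neighbours_across[OF nb[unfolded near_bipartition_sym[of K A B]] that(2)]
    unfolding hAB n_def by linarith
  have le_side: "real (card (N y \<inter> A)) \<le> a" "real (card (N y \<inter> B)) \<le> b" for y
    using nbD by (auto simp: a_def b_def intro: card_mono)
  have df_nonneg: "df y \<ge> 0" if "y \<in> L" for y
  proof (cases "y \<in> Lp")
    case True
    then show ?thesis using le_side[of y] by (simp add: df_def hAB Lp_def)
  next
    case False
    show ?thesis
    proof (cases "N y \<inter> B = {}")
      case True
      then show ?thesis using False le_side[of y] by (simp add: df_def hAB)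
    next
      case 2: False
      have "N y \<inter> A \<noteq> {}" using False that by (auto simp: Lp_def)
      from low[OF this 2] show ?thesis using False ab nr by (simp add: df_def)
    qed
  qed
  \<comment> \<open>The deficits are charged against \<open>(a + p) * (b + q) \<le> n\<^sup>2 / 4\<close>, the size of the completed bipartition.\<close>
  have npq: "n = (a + p) + (b + q)"
  proof -
    have "card V = card (A \<union> B) + card L" unfolding L_def
      using card_add_card_Diff[OF finV, of "A \<union> B"] nbD by (simp add: Int_absorb2 Diff_Diff_Int set_diff_eq Un_least conj_assoc)
    moreover have "card (A \<union> B) = card A + card B" using nbD by (intro card_Un_disjoint)
    moreover have "card L = card Lp + card Lq"
      using card_add_card_Diff[OF finL(1), of Lp] by (simp add: Lq_def Lp_def Int_absorb2)
    ultimately show ?thesis by (simp add: n_def a_def b_def p_def q_def)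
  qed
  have sum_df: "(\<Sum>y\<in>L. df y) \<le> n / 2 + (real C + 2 * (real K)\<^sup>2) / 4"
  proof -
    have "L \<inter> Lp = Lp" "L \<inter> - Lp = Lq" by (auto simp: Lp_def Lq_def)
    then have "(\<Sum>y\<in>L. (if y \<in> Lp then b else a)) = p * b + q * a"
      using finL by (simp add: sum.If_cases p_def q_def)
    then have s1: "(\<Sum>y\<in>L. df y) = p * b + q * a - (\<Sum>y\<in>L. h y)" by (simp add: df_def sum_subtractf)
    have z: "(\<Sum>u\<in>A. card (N u \<inter> A)) = 0" "(\<Sum>u\<in>B. card (N u \<inter> B)) = 0"
      using nbD(4,5) by (auto simp: indep_def)
    have e: "(\<Sum>u\<in>A. card (N u \<inter> B)) \<le> card A * card B"
      using sum_bounded_above[of A "\<lambda>u. card (N u \<inter> B)" "card B"] nbD by (simp add: card_mono)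
    have l: "(\<Sum>u\<in>L. card (N u \<inter> L)) \<le> card L * card L"
      using sum_bounded_above[of L "\<lambda>u. card (N u \<inter> L)" "card L"] finL by (simp add: card_mono)
    have "card L \<le> K" using nbD(6) unfolding L_def .
    then have l2: "card L * card L \<le> K * K" by (intro mult_le_mono)
    have "D \<le> 2 * (card A * card B) + 2 * (\<Sum>u\<in>L. card (N u \<inter> (A \<union> B))) + K * K"
      using D_split[OF nbD(1-3)] z e l l2 unfolding L_def by linarith
    then have "real D \<le> real (2 * (card A * card B) + 2 * (\<Sum>u\<in>L. card (N u \<inter> (A \<union> B))) + K * K)"
      by (rule of_nat_mono)
    also have "\<dots> = 2 * (a * b) + 2 * (\<Sum>u\<in>L. h u) + (real K)\<^sup>2"
      by (simp add: a_def b_def h_def power2_eq_square)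
    finally have D1: "real D \<le> 2 * (a * b) + 2 * (\<Sum>u\<in>L. h u) + (real K)\<^sup>2" .
    have "real ((card V)\<^sup>2) \<le> real (2 * D + 2 * card V + C)" using D by (rule of_nat_mono)
    then have D2: "n\<^sup>2 \<le> 2 * real D + 2 * n + real C" by (simp add: n_def)
    have pq: "p * q \<ge> 0" by (simp add: p_def q_def)
    have "4 * ((a + p) * (b + q)) = n\<^sup>2 - ((a + p) - (b + q))\<^sup>2"
      unfolding npq by (simp add: power2_eq_square algebra_simps)
    then have "4 * ((a + p) * (b + q)) \<le> n\<^sup>2" by simp
    then have "4 * (a * b + p * b + q * a) \<le> n\<^sup>2" using pq by (simp add: algebra_simps)
    then show ?thesis using s1 D1 D2 by argo
  qed
  have L_ne: "L \<noteq> {}"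
  proof
    assume "L = {}"
    then have "bipartition V A B" using nbD by (auto simp: bipartition_def L_def)
    then show False using nonbip by blast
  qed
  obtain x where x: "x \<in> L" "\<And>y. y \<in> L \<Longrightarrow> df y \<le> df x"
  proof -
    have "Max (df ` L) \<in> df ` L" using finL L_ne by (intro Max_in) auto
    then obtain x where "x \<in> L" "df x = Max (df ` L)" by auto
    then show thesis using finL by (intro that[of x]) auto
  qed
  have sum2: "(\<Sum>y\<in>L. df y) \<le> 51 / 100 * n" 
    using sum_df nr(3) nr(2) by linarith
  have one: "df u < 3 / 10 * n" if "u \<in> L" "u \<noteq> x" for u
  proof -
    have "df u + df x = (\<Sum>y\<in>{u, x}. df y)" using that by simp
    also have "\<dots> \<le> (\<Sum>y\<in>L. df y)" using that x finL df_nonneg by (intro sum_mono2) auto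
    finally show ?thesis using x(2)[OF that(1)] sum2 nr by linarith
  qed
  have two: "df u + df w < 4 / 10 * n" if "u \<in> L" "u \<noteq> x" "w \<in> L" "w \<noteq> x" "u \<noteq> w" for u w
  proof -
    have "df u + df w + df x = (\<Sum>y\<in>{u, w, x}. df y)" using that by simp
    also have "\<dots> \<le> (\<Sum>y\<in>L. df y)" using that x finL df_nonneg by (intro sum_mono2) auto
    finally show ?thesis using x(2)[OF that(1)] x(2)[OF that(3)] sum2 nr by linarith
  qed
  define P where "P = A \<union> Lp - {x}"
  define Q where "Q = B \<union> Lq - {x}"
  have indP: "indep P"
    unfolding indep_def
  proof (intro ballI equals0I)
    fix u w assume u: "u \<in> P" and w: "w \<in> N u \<inter> P"
    have "u \<notin> A" using u w nbD(4) N_sym[of w u] by (auto simp: P_def Lp_def indep_def)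
    moreover have "w \<notin> A" using u w nbD(4) by (auto simp: P_def Lp_def indep_def)
    ultimately have uw: "u \<in> Lp" "u \<noteq> x" "w \<in> Lp" "w \<noteq> x" "w \<noteq> u" using u w N_irr by (auto simp: P_def)
    then have "df u + df w = 2 * b - real (card (N u \<inter> B) + card (N w \<inter> B))"
      by (simp add: df_def hAB Lp_def)
    then have "df u + df w \<ge> b - real r"
      using adjacent_degree_sum[of w u B] w nbD(12) unfolding b_def by simp
    then show False using two[of u w] uw ab nr by (simp add: Lp_def)
  qed
  have lowq: "N u \<inter> B = {}" if "u \<in> Lq" "u \<noteq> x" for u
  proof (rule ccontr)
    assume "N u \<inter> B \<noteq> {}"
    moreover have "u \<in> L" "u \<notin> Lp" "N u \<inter> A \<noteq> {}" using that by (auto simp: Lp_def Lq_def)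
    ultimately have "df u \<ge> a - (n / 25 + 2 * real r)" using low[of u] by (simp add: df_def)
    then show False using one[OF \<open>u \<in> L\<close> that(2)] ab nr by linarith
  qed
  have indQ: "indep Q"
    unfolding indep_def
  proof (intro ballI equals0I)
    fix u w assume u: "u \<in> Q" and w: "w \<in> N u \<inter> Q"
    have "u \<notin> B" using u w nbD(5) N_sym[of w u] lowq[of w] by (auto simp: Q_def indep_def)
    moreover have "w \<notin> B" using u w nbD(5) lowq[of u] by (auto simp: Q_def indep_def)
    ultimately have uw: "u \<in> Lq" "u \<noteq> x" "w \<in> Lq" "w \<noteq> x" "w \<noteq> u" using u w N_irr by (auto simp: Q_def)
    then have "df u + df w = 2 * a - real (card (N u \<inter> A) + card (N w \<inter> A))"
      by (simp add: df_def hAB Lq_def lowq)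
    then have "df u + df w \<ge> a - real r"
      using adjacent_degree_sum[of w u A] w nbD(11) unfolding a_def by simp
    then show False using two[of u w] uw ab nr by (simp add: Lq_def)
  qed
  have "bipartition (V - {x}) P Q"
    unfolding bipartition_def using indP indQ nbD(1-3) x(1)
    by (auto simp: P_def Q_def Lq_def Lp_def L_def)
  then show ?thesis using x(1) by (auto simp: L_def)
qed

section \<open>The number of edges\<close>

text \<open>
  The number \<open>\<lfloor>k\<^sup>2/4\<rfloor>\<close> of edges of the balanced complete bipartite graph on \<open>k\<close> vertices.
\<close>

definition turan2 :: "nat \<Rightarrow> nat" where
  "turan2 k = (k div 2) * (k - k div 2)"

lemma product_le_turan2: "a * b \<le> turan2 (a + b)"
proof -
  define c f where "c = (a + b) div 2" and "f = a + b - c"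
  have cf: "a + b = c + f" "f = c \<or> f = c + 1" by (auto simp: c_def f_def)
  define d where "d = int a - int c"
  have d: "int a = int c + d" "int b = int f - d" using cf(1) by (simp_all add: d_def)
  have "d \<le> d * d"
  proof (cases "d \<le> 0")
    case True
    then show ?thesis using zero_le_square[of d] by linarith
  next
    case False
    then show ?thesis using mult_left_mono[of 1 d d] by simp
  qed
  then have "d * (int f - int c) \<le> d * d" using cf(2) zero_le_square[of d] by auto
  then have "int a * int b \<le> int c * int f" unfolding d by (simp add: algebra_simps)
  then have "a * b \<le> c * f" by (simp flip: of_nat_mult)
  then show ?thesis by (simp add: turan2_def c_def f_def)
qed

lemma turan2_bounds: "k * k \<le> 4 * turan2 k + 1" "4 * turan2 k \<le> k * k"
proof -
  obtain m where "k = 2 * m \<or> k = 2 * m + 1" by (metis oddE evenE)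
  then show "k * k \<le> 4 * turan2 k + 1" "4 * turan2 k \<le> k * k"
    by (auto simp: turan2_def algebra_simps)
qed

context simple_graph
begin

definition missing :: "'a set \<Rightarrow> 'a set \<Rightarrow> nat" where
  "missing A B = (\<Sum>u\<in>A. card (B - N u))"

lemma missing_add:
  assumes "finite B"
  shows "(\<Sum>u\<in>A. card (N u \<inter> B)) + missing A B = card A * card B"
proof -
  have "(\<Sum>u\<in>A. card (N u \<inter> B)) + missing A B = (\<Sum>u\<in>A. card B)"
    by (simp only: missing_def card_add_card_Diff[OF assms] flip: sum.distrib)
  then show ?thesis by simp
qed

lemma missing_sym:
  assumes "finite A" "finite B"
  shows "missing A B = missing B A"
  using missing_add[of B A] missing_add[of A B] double_count[of A B] assms by (simp add: mult.commute)

text \<open>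
  If \<open>G - x\<close> is bipartite, its edges are the cross pairs that are not missing and the edges at \<open>x\<close>.
\<close>

lemma D_deleted:
  assumes "x \<in> V" "bipartition (V - {x}) A B"
  shows "D + 2 * missing A B = 2 * (card A * card B) + 2 * (card (N x \<inter> A) + card (N x \<inter> B))"
    and "card A + card B + 1 = card V"
proof -
  have AB: "A \<union> B = V - {x}" "A \<inter> B = {}" "indep A" "indep B" using assms by (auto simp: bipartition_def)
  have sub: "A \<subseteq> V" "B \<subseteq> V" using AB by auto
  have fin: "finite A" "finite B" using sub finV finite_subset by auto
  have R: "V - A - B = {x}" using AB assms by auto
  have z: "(\<Sum>u\<in>A. card (N u \<inter> A)) = 0" "(\<Sum>u\<in>B. card (N u \<inter> B)) = 0"
    using AB by (auto simp: indep_def)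
  have "card (N x \<inter> (A \<union> B)) = card (N x \<inter> A) + card (N x \<inter> B)"
    unfolding Int_Un_distrib by (rule card_Un_disjoint) (use fin AB in auto)
  then show "D + 2 * missing A B = 2 * (card A * card B) + 2 * (card (N x \<inter> A) + card (N x \<inter> B))"
    using D_split[OF sub AB(2)] missing_add[OF fin(2), of A] z N_irr unfolding R by simp
  show "card A + card B + 1 = card V"
    using card_Un_disjoint[OF fin AB(2)] assms finV AB(1) by (metis Suc_eq_plus1 card_Suc_Diff1)
qed

lemma neighbours_in_both_classes:
  assumes "x \<in> V" "bipartition (V - {x}) A B" "\<nexists>P Q. bipartition V P Q"
  shows "N x \<inter> A \<noteq> {}" "N x \<inter> B \<noteq> {}"
proof -
  have *: "N x \<inter> A \<noteq> {}" if b: "bipartition (V - {x}) A B" for A B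
  proof
    assume "N x \<inter> A = {}"
    then have "bipartition V (insert x A) B"
      using b assms(1) N_irr N_sym unfolding bipartition_def indep_def by blast
    then show False using assms(3) by blast
  qed
  show "N x \<inter> A \<noteq> {}" using *[OF assms(2)] .
  show "N x \<inter> B \<noteq> {}" using *[of B A] assms(2) bipartition_sym by blast
qed

end

context book_free_graph
begin

text \<open>
  A neighbour \<open>u\<close> of \<open>x\<close> has at most \<open>r\<close> common neighbours with \<open>x\<close>, so it misses all but \<open>r\<close> of the
  neighbours of \<open>x\<close> in the other class.
\<close>

lemma missing_at_neighbour:
  assumes "u \<in> N x" "finite B"
  shows "card (N x \<inter> B) \<le> r + card (N x \<inter> B - N u)"
proof -
  have "card (N u \<inter> (N x \<inter> B)) \<le> card (N x \<inter> N u)" by (intro card_mono) auto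
  then show ?thesis using card_add_card_Diff[of "N x \<inter> B" "N u"] codeg[OF assms(1)] by simp
qed

lemma missing_lower:
  assumes "finite A" "finite B"
  shows "card (N x \<inter> A) * card (N x \<inter> B) \<le> missing A B + r * card (N x \<inter> A)"
proof -
  have "card (N x \<inter> A) * card (N x \<inter> B) \<le> (\<Sum>u\<in>N x \<inter> A. r + card (B - N u))"
  proof -
    have "card (N x \<inter> B) \<le> r + card (B - N u)" if "u \<in> N x \<inter> A" for u
    proof -
      have "card (N x \<inter> B - N u) \<le> card (B - N u)" using assms by (intro card_mono) auto
      then show ?thesis using missing_at_neighbour[of u x B] that assms by auto
    qed
    then show ?thesis
      using sum_bounded_below[of "N x \<inter> A" "card (N x \<inter> B)" "\<lambda>u. r + card (B - N u)"] by simp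
  qed
  also have "\<dots> = r * card (N x \<inter> A) + (\<Sum>u\<in>N x \<inter> A. card (B - N u))"
    by (simp add: sum.distrib)
  also have "(\<Sum>u\<in>N x \<inter> A. card (B - N u)) \<le> missing A B"
    unfolding missing_def using assms by (intro sum_mono2) auto
  finally show ?thesis by simp
qed

text \<open>
  With \<open>s, t \<ge> 1\<close> neighbours of \<open>x\<close> in the two classes there are at least \<open>s(t - r)\<close> and \<open>t(s - r)\<close>
  missing pairs. If one of \<open>s\<close>, \<open>t\<close> exceeds \<open>r\<close>, this leaves a gain of at most \<open>r + 1 \<le> 2r\<close>;
  otherwise \<open>s + t \<le> 2r\<close> directly.
\<close>

lemma gain_le:
  assumes "r \<ge> 1" "x \<in> V" "bipartition (V - {x}) A B" "\<nexists>P Q. bipartition V P Q"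
  shows "card (N x \<inter> A) + card (N x \<inter> B) \<le> missing A B + 2 * r"
proof -
  have fin: "finite A" "finite B" using assms(3) finV by (auto simp: bipartition_def intro: finite_subset[of _ V])
  define s t m where "s = int (card (N x \<inter> A))" and "t = int (card (N x \<inter> B))" and "m = int (missing A B)"
  define R where "R = int r"
  have st: "s \<ge> 1" "t \<ge> 1"
    using neighbours_in_both_classes[OF assms(2-4)] fin by (auto simp: s_def t_def card_gt_0_iff Suc_le_eq)
  have m1: "s * t \<le> m + R * s"
    using missing_lower[OF fin, of x] unfolding s_def t_def m_def R_def by (metis of_nat_add of_nat_le_iff of_nat_mult)
  have m2: "s * t \<le> m + R * t"
    using missing_lower[OF fin(2,1), of x] missing_sym[OF fin] unfolding s_def t_def m_def R_def
    by (metis of_nat_add of_nat_le_iff of_nat_mult mult.commute)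
  have R: "R \<ge> 1" using assms by (simp add: R_def)
  have m0: "m \<ge> 0" by (simp add: m_def)
  have "s + t \<le> m + 2 * R"
  proof (cases "t > R")
    case True
    have "(s - 1) * (t - R - 1) \<ge> 0" using True st by simp
    then show ?thesis using m1 st R by (simp add: algebra_simps)
  next
    case t: False
    show ?thesis
    proof (cases "s > R")
      case True
      have "(t - 1) * (s - R - 1) \<ge> 0" using True st by simp
      then show ?thesis using m2 st R by (simp add: algebra_simps)
    qed (use t m0 in linarith)
  qed
  then show ?thesis by (simp add: s_def t_def m_def R_def)
qed

lemma edges_le:
  assumes "r \<ge> 1" "x \<in> V" "bipartition (V - {x}) A B" "\<nexists>P Q. bipartition V P Q"
  shows "D \<le> 2 * turan2 (card V - 1) + 4 * r"
proof -
  have "card A + card B = card V - 1" using D_deleted(2)[OF assms(2,3)] by simp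
  then have "card A * card B \<le> turan2 (card V - 1)" using product_le_turan2[of "card A" "card B"] by simp
  moreover have "d \<le> 2 * t + 4 * r" if "p \<le> t" "d + 2 * m = 2 * p + 2 * s" "s \<le> m + 2 * r" for d p s m t :: nat
    using that by linarith
  ultimately show ?thesis using D_deleted(1)[OF assms(2,3)] gain_le[OF assms] by blast
qed

end

section \<open>Perron vectors of book-free graphs\<close>

context simple_graph
begin

text \<open>
  An arc leaving \<open>N u\<close> is counted in the degree sum of \<open>N u\<close>, and its reverse is counted in the
  degree sum of the complement; only the arcs inside \<open>N u\<close> are not matched in this way.
\<close>

lemma degree_sum_nbhd:
  "2 * (\<Sum>w\<in>N u. card (N w)) \<le> D + (\<Sum>w\<in>N u. card (N w \<inter> N u))"
proof -
  have "(\<Sum>w\<in>N u. card (N w)) = (\<Sum>w\<in>N u. card (N w \<inter> N u)) + (\<Sum>w\<in>N u. card (N w \<inter> (V - N u)))"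
  proof -
    have "card (N w) = card (N w \<inter> N u) + card (N w \<inter> (V - N u))" for w
    proof -
      have "N w \<inter> (V - N u) = N w - N u" using N_sub by blast
      then show ?thesis using card_add_card_Diff[of "N w" "N u"] by (simp add: Int_commute)
    qed
    then show ?thesis by (simp add: sum.distrib)
  qed
  moreover have "(\<Sum>w\<in>N u. card (N w \<inter> (V - N u))) = (\<Sum>w\<in>V - N u. card (N w \<inter> N u))"
    by (rule double_count) (use finV in auto)
  moreover have "(\<Sum>w\<in>V - N u. card (N w \<inter> N u)) \<le> (\<Sum>w\<in>V - N u. card (N w))"
    by (intro sum_mono card_mono) auto
  moreover have "D = (\<Sum>w\<in>V - N u. card (N w)) + (\<Sum>w\<in>N u. card (N w))"
    by (rule sum.subset_diff[OF N_sub finV])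
  ultimately show ?thesis by linarith
qed

end

text \<open>
  The nonnegative eigenvector is scaled so that its largest entry, at \<open>top_v\<close>, equals \<open>1\<close>.
\<close>

locale perron_graph = book_free_graph V N r
  for V :: "'a set" and N :: "'a \<Rightarrow> 'a set" and r :: nat +
  fixes z :: "'a \<Rightarrow> real" and \<rho> :: real and top_v :: 'a
  assumes z_nonneg: "z v \<ge> 0" and z_le_1: "v \<in> V \<Longrightarrow> z v \<le> 1"
    and top_v: "top_v \<in> V" "z top_v = 1"
    and eig: "u \<in> V \<Longrightarrow> (\<Sum>v\<in>N u. z v) = \<rho> * z u"
    and rho_pos: "\<rho> > 0"
begin

lemma sum_z_le_card:
  assumes "X \<subseteq> V"
  shows "(\<Sum>v\<in>X. z v) \<le> real (card X)"
  using sum_mono[of X z "\<lambda>_. 1"] z_le_1 assms by auto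

lemma rho_le_degree: "\<rho> \<le> real (card (N top_v))"
  using eig[OF top_v(1)] top_v(2) sum_z_le_card[OF N_sub, of top_v] by simp

text \<open>
  Applying the eigenvalue equation twice at \<open>top_v\<close> sums \<open>z \<le> 1\<close> over all walks of length two.
\<close>

lemma rho_square_le_walks: "\<rho>\<^sup>2 \<le> real (\<Sum>w\<in>N top_v. card (N w))"
proof -
  have "\<rho>\<^sup>2 = \<rho> * (\<Sum>w\<in>N top_v. z w)" using eig[OF top_v(1)] top_v(2) by (simp add: power2_eq_square)
  also have "\<dots> = (\<Sum>w\<in>N top_v. \<Sum>v\<in>N w. z v)"
    unfolding sum_distrib_left by (intro sum.cong refl eig[symmetric] subsetD[OF N_sub])
  also have "\<dots> \<le> (\<Sum>w\<in>N top_v. real (card (N w)))"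
    by (intro sum_mono sum_z_le_card N_sub)
  finally show ?thesis by simp
qed

lemma rho_square_le: "2 * \<rho>\<^sup>2 \<le> real (D + (\<Sum>w\<in>N top_v. card (N w \<inter> N top_v)))"
proof -
  have "2 * \<rho>\<^sup>2 \<le> real (2 * (\<Sum>w\<in>N top_v. card (N w)))" using rho_square_le_walks by simp
  also have "\<dots> \<le> real (D + (\<Sum>w\<in>N top_v. card (N w \<inter> N top_v)))"
    by (intro of_nat_mono degree_sum_nbhd)
  finally show ?thesis .
qed

lemma codeg_nbhd: "w \<in> N u \<Longrightarrow> card (N w \<inter> N u) \<le> r"
  using codeg[of w u] by (simp add: Int_commute)

lemma rho_square_le_crude: "2 * \<rho>\<^sup>2 \<le> real (D + r * card V)"
proof -
  have "(\<Sum>w\<in>N top_v. card (N w \<inter> N top_v)) \<le> card (N top_v) * r"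
    using sum_bounded_above[of "N top_v" "\<lambda>w. card (N w \<inter> N top_v)" r] codeg_nbhd by simp
  also have "\<dots> \<le> r * card V" using card_mono[OF finV N_sub[of top_v]] by (simp add: mult.commute)
  finally have "D + (\<Sum>w\<in>N top_v. card (N w \<inter> N top_v)) \<le> D + r * card V" by simp
  then have "real (D + (\<Sum>w\<in>N top_v. card (N w \<inter> N top_v))) \<le> real (D + r * card V)" by (rule of_nat_mono)
  then show ?thesis using rho_square_le by linarith
qed

text \<open>
  The degree of \<open>top_v\<close> is at least \<open>\<rho>\<close>, too large for a vertex with neighbours in both
  classes. So its neighbourhood lies in one independent class and the exceptional set \<open>L\<close>; every arc
  inside it has an end in \<open>L\<close>, and each of the at most \<open>K\<close> vertices there has at most \<open>r\<close> common
  neighbours with \<open>top_v\<close>.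
\<close>

lemma rho_square_le_refined:
  assumes nb: "near_bipartition K A B" and big: "50 * \<rho> > 100 * real r + 2 * real (card V) + 50 * real K"
  shows "2 * \<rho>\<^sup>2 \<le> real (D + 2 * K * r)"
proof -
  let ?u = top_v
  have inner: "(\<Sum>w\<in>N ?u. card (N w \<inter> N ?u)) \<le> 2 * K * r"
    if nb: "near_bipartition K A B" and disj: "N ?u \<inter> A = {}" for A B
  proof -
    note nbD = near_bipartitionD[OF nb]
    define L where "L = N ?u - B"
    have finL: "finite L" by (simp add: L_def)
    have "L \<subseteq> V - A - B" using disj N_sub by (auto simp: L_def)
    then have LK: "card L \<le> K" using nbD(6) finV by (meson card_mono finite_Diff le_trans)
    have few: "(\<Sum>w\<in>L. card (N w \<inter> N ?u)) \<le> K * r"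
    proof -
      have "(\<Sum>w\<in>L. card (N w \<inter> N ?u)) \<le> card L * r"
        using sum_bounded_above[of L "\<lambda>w. card (N w \<inter> N ?u)" r] codeg_nbhd[of _ ?u] by (simp add: L_def)
      also have "\<dots> \<le> K * r" using LK by simp
      finally show ?thesis .
    qed
    have "(\<Sum>w\<in>N ?u \<inter> B. card (N w \<inter> N ?u)) \<le> (\<Sum>w\<in>N ?u \<inter> B. card (N w \<inter> L))"
      using nbD(5) by (intro sum_mono card_mono) (auto simp: L_def indep_def)
    also have "\<dots> = (\<Sum>w\<in>L. card (N w \<inter> (N ?u \<inter> B)))"
      by (rule double_count) (auto simp: finL)
    also have "\<dots> \<le> (\<Sum>w\<in>L. card (N w \<inter> N ?u))"
      by (intro sum_mono card_mono) auto
    also note few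
    finally have "(\<Sum>w\<in>N ?u \<inter> B. card (N w \<inter> N ?u)) \<le> K * r" .
    moreover have "(\<Sum>w\<in>N ?u. card (N w \<inter> N ?u))
      = (\<Sum>w\<in>N ?u \<inter> B. card (N w \<inter> N ?u)) + (\<Sum>w\<in>L. card (N w \<inter> N ?u))"
      unfolding L_def by (subst sum.Int_Diff[of "N ?u" _ B]) auto
    ultimately show ?thesis using few by linarith
  qed
  have "N ?u \<inter> A = {} \<or> N ?u \<inter> B = {}"
  proof (rule ccontr)
    assume neg: "\<not> ?thesis"
    note nbD = near_bipartitionD[OF nb]
    have "card (N ?u) \<le> card ((N ?u \<inter> A) \<union> (N ?u \<inter> B) \<union> (V - A - B))"
      using N_sub finV by (intro card_mono) auto
    also have "\<dots> \<le> card (N ?u \<inter> A) + card (N ?u \<inter> B) + card (V - A - B)"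
      using card_Un_le[of "(N ?u \<inter> A) \<union> (N ?u \<inter> B)" "V - A - B"] card_Un_le[of "N ?u \<inter> A" "N ?u \<inter> B"] by linarith
    finally have "50 * card (N ?u) \<le> 100 * r + 2 * card V + 50 * K"
      using few_neighbours_across[OF nb, of ?u] few_neighbours_across[OF nb[unfolded near_bipartition_sym[of K A B]], of ?u]
        neg nbD(6) by linarith
    then have "real (50 * card (N ?u)) \<le> real (100 * r + 2 * card V + 50 * K)" by (rule of_nat_mono)
    then show False using big rho_le_degree by simp
  qed
  then have "(\<Sum>w\<in>N ?u. card (N w \<inter> N ?u)) \<le> 2 * K * r"
    using inner[OF nb] inner[OF nb[unfolded near_bipartition_sym[of K A B]]] by blast
  then have "real (D + (\<Sum>w\<in>N top_v. card (N w \<inter> N top_v))) \<le> real (D + 2 * K * r)"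
    by (intro of_nat_mono add_left_mono)
  then show ?thesis using rho_square_le by linarith
qed

definition weight :: "'a set \<Rightarrow> real" where "weight X = (\<Sum>v\<in>X. z v)"

lemma weight_nonneg: "weight X \<ge> 0"
  by (simp add: weight_def sum_nonneg z_nonneg)

lemma weight_split:
  assumes "finite B"
  shows "weight (N u \<inter> B) = weight B - weight (B - N u)"
  using sum.Int_Diff[OF assms, of z "N u"] by (simp add: weight_def Int_commute)

context
  fixes x A B
  assumes x: "x \<in> V" and classes: "bipartition (V - {x}) A B"
begin

lemma classesD: "A \<union> B = V - {x}" "A \<inter> B = {}" "indep A" "indep B" "finite A" "finite B"
  "A \<subseteq> V" "B \<subseteq> V" "x \<notin> A" "x \<notin> B"
  using classes finV by (auto simp: bipartition_def intro: finite_subset[of _ V])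

lemma nbhd_class: "u \<in> A \<Longrightarrow> N u = (N u \<inter> B) \<union> (if u \<in> N x then {x} else {})"
  using classesD(1,3) N_sub[of u] N_sym[of x u] N_sym[of u x] by (auto simp: indep_def split: if_splits)

lemma rho_z_class:
  assumes "u \<in> A"
  shows "\<rho> * z u = weight B - weight (B - N u) + (if u \<in> N x then z x else 0)"
proof -
  have "\<rho> * z u = (\<Sum>v\<in>(N u \<inter> B) \<union> (if u \<in> N x then {x} else {}). z v)"
    using eig[of u] nbhd_class[OF assms] assms classesD by (metis subsetD)
  also have "\<dots> = weight (N u \<inter> B) + (if u \<in> N x then z x else 0)"
    unfolding weight_def using classesD by (subst sum.union_disjoint) auto
  finally show ?thesis using weight_split[OF classesD(6)] by simp
qed

lemma rho_weight_class:
  "\<rho> * weight A = real (card A) * weight B - (\<Sum>u\<in>A. weight (B - N u)) + real (card (N x \<inter> A)) * z x"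
proof -
  have "\<rho> * weight A = (\<Sum>u\<in>A. weight B - weight (B - N u) + (if u \<in> N x then z x else 0))"
    unfolding weight_def[of A] sum_distrib_left by (intro sum.cong refl rho_z_class)
  also have "\<dots> = real (card A) * weight B - (\<Sum>u\<in>A. weight (B - N u)) + (\<Sum>u\<in>A. if u \<in> N x then z x else 0)"
    by (simp add: sum.distrib sum_subtractf)
  also have "(\<Sum>u\<in>A. if u \<in> N x then z x else 0) = real (card (N x \<inter> A)) * z x"
    using classesD by (simp add: sum.If_cases Int_commute)
  finally show ?thesis .
qed

lemma rho_z_x: "\<rho> * z x = weight (N x \<inter> A) + weight (N x \<inter> B)"
proof -
  have "N x = (N x \<inter> A) \<union> (N x \<inter> B)" using classesD(1) N_sub[of x] N_irr[of x] by blast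
  then have "\<rho> * z x = (\<Sum>v\<in>(N x \<inter> A) \<union> (N x \<inter> B). z v)" using eig[OF x] by simp
  then show ?thesis unfolding weight_def using classesD by (subst (asm) sum.union_disjoint) auto
qed

lemma rho_z_x_le: "\<rho> * z x \<le> real (card (N x \<inter> A) + card (N x \<inter> B))"
proof -
  have "weight (N x \<inter> A) \<le> real (card (N x \<inter> A))" "weight (N x \<inter> B) \<le> real (card (N x \<inter> B))"
    unfolding weight_def by (intro sum_z_le_card; use classesD in auto)+
  then show ?thesis using rho_z_x by simp
qed

end

text \<open>
  Summing the eigenvalue equation over \<open>A\<close> and over \<open>B\<close> expresses \<open>\<rho>\<close> times each class weight through
  the other one, with corrections from \<open>x\<close> and from the missing pairs; substituting one into the
  other isolates \<open>\<rho>\<^sup>2 - |A||B|\<close>. The correction for missing pairs seen from \<open>B\<close> is dropped, which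
  turns the equation into an upper bound.
\<close>

lemma rho_square_identity:
  assumes x: "x \<in> V" and classes: "bipartition (V - {x}) A B"
  shows "(\<rho>\<^sup>2 - real (card A) * real (card B)) * weight A
    \<le> (real (card A) * real (card (N x \<inter> B)) + \<rho> * real (card (N x \<inter> A))) * z x
       - \<rho> * (\<Sum>u\<in>A. weight (B - N u))"
proof -
  have classes': "bipartition (V - {x}) B A" using classes bipartition_sym by blast
  have 1: "\<rho> * weight A = real (card A) * weight B - (\<Sum>u\<in>A. weight (B - N u)) + real (card (N x \<inter> A)) * z x"
    by (rule rho_weight_class[OF x classes])
  have "\<rho> * weight B = real (card B) * weight A - (\<Sum>u\<in>B. weight (A - N u)) + real (card (N x \<inter> B)) * z x"
    by (rule rho_weight_class[OF x classes'])
  then have 2: "\<rho> * weight B \<le> real (card B) * weight A + real (card (N x \<inter> B)) * z x"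
    using sum_nonneg[of B "\<lambda>u. weight (A - N u)"] weight_nonneg by simp
  have "\<rho>\<^sup>2 * weight A = \<rho> * (\<rho> * weight A)" by (simp add: power2_eq_square)
  also have "\<dots> = real (card A) * (\<rho> * weight B) - \<rho> * (\<Sum>u\<in>A. weight (B - N u)) + \<rho> * real (card (N x \<inter> A)) * z x"
    unfolding 1 by (simp add: algebra_simps)
  also have "\<dots> \<le> real (card A) * (real (card B) * weight A + real (card (N x \<inter> B)) * z x)
      - \<rho> * (\<Sum>u\<in>A. weight (B - N u)) + \<rho> * real (card (N x \<inter> A)) * z x"
    using mult_left_mono[OF 2, of "real (card A)"] by simp
  finally show ?thesis by (simp add: algebra_simps)
qed

lemma missing_le_at:
  assumes "finite A" "finite B" "v \<in> B"
  shows "card (A - N v) \<le> missing A B"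
  unfolding missing_sym[OF assms(1,2)] unfolding missing_def[of B A]
  by (rule member_le_sum) (use assms in auto)

end

section \<open>The structure of graphs with large spectral radius\<close>

context perron_graph
begin

text \<open>
  The vertex \<open>x\<close> is chosen of minimum degree among the vertices whose deletion leaves a bipartite
  graph, and \<open>A\<close> is the class containing fewer of its neighbours, so \<open>s \<le> t\<close>. Each of \<open>\<rho>\<close>,
  \<open>|A|\<close> and \<open>|B|\<close> is close to \<open>n/2\<close>. By \<open>rho_square_identity\<close>, \<open>\<rho>\<^sup>2 \<ge> |A||B|\<close> is impossible
  as soon as the missing pairs outweigh the gain \<open>O((s + t)\<^sup>2)\<close> from \<open>x\<close>.

  If \<open>t\<close> is bounded, the gain is bounded, whereas a single missing pair costs about \<open>n/2\<close>. If \<open>t\<close> is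
  large, counting edges forces \<open>s = 1\<close>. The only neighbour \<open>v\<close> of \<open>x\<close> in \<open>A\<close> then plays a role
  symmetric to \<open>x\<close>: deleting \<open>v\<close> also leaves a bipartite graph. Minimality of the degree of \<open>x\<close> gives
  \<open>2t \<le> |B| + r\<close>, so \<open>t\<close> is at most about \<open>n/4\<close>, and the at least \<open>t - r\<close> missing pairs at \<open>v\<close> cost
  about \<open>(t - r)n/2\<close>, more than the gain of about \<open>t\<^sup>2\<close>.
\<close>

lemma extremal_structure:
  fixes C :: nat
  defines "K \<equiv> 3 * r + 2 + C" and "F \<equiv> turan2 (card V - 1)"
  assumes r: "r \<ge> 1" and nonbip: "\<nexists>P Q. bipartition V P Q"
    and rho: "real F \<le> \<rho>\<^sup>2" and edges: "2 * F \<le> D + C"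
    and del: "\<exists>x\<in>V. \<exists>P Q. bipartition (V - {x}) P Q"
    and large: "card V > 1000 * (K + 1)\<^sup>2"
  shows "\<exists>x\<in>V. \<exists>A B. bipartition (V - {x}) A B \<and> missing A B = 0 \<and> card A * card B = F
     \<and> card (N x \<inter> A) \<le> card (N x \<inter> B) \<and> (\<forall>b\<in>B. z b > 0)"
proof -
  obtain x where x: "x \<in> V" "\<exists>P Q. bipartition (V - {x}) P Q"
    and min: "\<And>y. y \<in> V \<Longrightarrow> \<exists>P Q. bipartition (V - {y}) P Q \<Longrightarrow> card (N x) \<le> card (N y)"
    using ex_has_least_nat[of "\<lambda>x. x \<in> V \<and> (\<exists>P Q. bipartition (V - {x}) P Q)" _ "\<lambda>x. card (N x)"] del by blast
  obtain A B where AB: "bipartition (V - {x}) A B" and sle: "card (N x \<inter> A) \<le> card (N x \<inter> B)"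
    using x(2) bipartition_sym nat_le_linear by metis
  note ABD = classesD[OF x(1) AB]
  define s t m where "s = card (N x \<inter> A)" and "t = card (N x \<inter> B)" and "m = missing A B"
  define a b n where "a = real (card A)" and "b = real (card B)" and "n = real (card V)"
  define \<alpha> where "\<alpha> = weight A"
  define M where "M = (\<Sum>u\<in>A. weight (B - N u))"
  have st: "s \<ge> 1" "t \<ge> 1" "s \<le> t"
    using neighbours_in_both_classes[OF x(1) AB nonbip] ABD sle by (auto simp: s_def t_def card_gt_0_iff Suc_le_eq)
  have dl: "D + 2 * m = 2 * (card A * card B) + 2 * (s + t)" and cV: "card A + card B + 1 = card V"
    using D_deleted[OF x(1) AB] by (simp_all add: s_def t_def m_def)
  have gain: "s + t \<le> m + 2 * r" using gain_le[OF r x(1) AB nonbip] by (simp add: s_def t_def m_def)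
  have abF: "card A * card B \<le> F" using product_le_turan2[of "card A" "card B"] cV unfolding F_def by (metis add_diff_cancel_right')
  have mle: "2 * m \<le> 2 * (s + t) + C"
    and abl: "2 * F \<le> 2 * (card A * card B) + 4 * r + C"
  proof -
    have "2 * m \<le> 2 * st + C \<and> 2 * F \<le> 2 * p + 4 * r + C"
      if "d + 2 * m = 2 * p + 2 * st" "st \<le> m + 2 * r" "p \<le> F" "2 * F \<le> d + C" for d p st :: nat
      using that by linarith
    from this[OF dl gain abF edges]
    show "2 * m \<le> 2 * (s + t) + C" "2 * F \<le> 2 * (card A * card B) + 4 * r + C" by blast+
  qed
  have mle': "2 * m \<le> 2 * s + 2 * t + C" using mle by simp
  have Fb: "(n - 1)\<^sup>2 \<le> 4 * real F + 1" "4 * real F \<le> (n - 1)\<^sup>2"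
  proof -
    have n1: "real (card V - 1) = n - 1" using cV by (simp add: n_def)
    have "real ((card V - 1) * (card V - 1)) \<le> real (4 * F + 1)"
      unfolding F_def by (intro of_nat_mono turan2_bounds)
    then show "(n - 1)\<^sup>2 \<le> 4 * real F + 1" unfolding of_nat_mult n1 by (simp add: power2_eq_square)
    have "real (4 * F) \<le> real ((card V - 1) * (card V - 1))"
      unfolding F_def by (intro of_nat_mono turan2_bounds)
    then show "4 * real F \<le> (n - 1)\<^sup>2" unfolding of_nat_mult n1 by (simp add: power2_eq_square)
  qed
  define k where "k = real K"
  have kdef: "k = 3 * real r + 2 + real C" by (simp add: k_def K_def)
  have k0: "k \<ge> 5" "real r \<ge> 1" using r by (auto simp: kdef)
  have nk2: "n > 1000 * (k + 1)\<^sup>2"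
    using of_nat_less_iff[where ?'a = real, THEN iffD2, OF large] by (simp add: n_def k_def add.commute)
  have k2: "k * k \<ge> 5 * k" using k0 by (intro mult_right_mono) auto
  have nk: "1000 * (k * k) < n" "n > 1000" "1000 * k < n"
  proof -
    have "1000 * (k * k) + 2000 * k + 1000 < n" using nk2 by (simp add: power2_eq_square algebra_simps)
    then show "1000 * (k * k) < n" "n > 1000" "1000 * k < n" using k0 k2 by linarith+
  qed
  have ab1: "a + b = n - 1" using cV by (simp add: a_def b_def n_def)
  have ablr: "2 * real F \<le> 2 * (a * b) + 4 * real r + real C"
    using of_nat_mono[OF abl, where ?'a = real] by (simp add: a_def b_def)
  have abFr: "a * b \<le> real F" using of_nat_mono[OF abF, where ?'a = real] by (simp add: a_def b_def)
  have adiff: "\<bar>a - b\<bar> \<le> n / 100"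
  proof -
    have "(a - b)\<^sup>2 = (a + b)\<^sup>2 - 4 * (a * b)" by (simp add: power2_eq_square algebra_simps)
    also have "\<dots> \<le> 1 + 8 * real r + 2 * real C" using ab1 Fb(1) ablr by simp
    also have "\<dots> \<le> n" using nk(3) k0 kdef by linarith
    also have "n \<le> (n / 100)\<^sup>2"
    proof -
      have "10000 * n \<le> n * n" if "n \<ge> 10000" using that by (intro mult_right_mono) auto
      moreover have "n \<ge> 10000" using nk(1) k0 k2 by linarith
      ultimately show ?thesis by (simp add: power2_eq_square)
    qed
    finally have "\<bar>a - b\<bar> \<le> \<bar>n / 100\<bar>" by (rule abs_le_square_iff[THEN iffD2])
    then show ?thesis using nk by simp
  qed
  have a: "49/100 * n \<le> a" "a \<le> 505/1000 * n" and b: "49/100 * n \<le> b" "b \<le> 505/1000 * n"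
  proof -
    have d: "a - b \<le> n / 100" "b - a \<le> n / 100" using adiff by linarith+
    show "49/100 * n \<le> a" using d ab1 nk(2) by linarith
    show "a \<le> 505/1000 * n" using d ab1 nk(2) by linarith
    show "49/100 * n \<le> b" using d ab1 nk(2) by linarith
    show "b \<le> 505/1000 * n" using d ab1 nk(2) by linarith
  qed
  have nn: "1000 * n \<le> n * n" using nk(2) by (intro mult_right_mono) auto
  have n1sq: "(n - 1)\<^sup>2 = n * n - 2 * n + 1" by (simp add: power2_eq_square algebra_simps)
  \<comment> \<open>The numerical bounds below leave room for all lower-order terms once \<open>n\<close> is large.\<close>
  have rho_lo: "49/100 * n \<le> \<rho>"
  proof (rule power2_le_imp_le)
    have "(49/100 * n)\<^sup>2 = 2401/10000 * (n * n)" by (simp add: power2_eq_square)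
    also have "\<dots> \<le> ((n - 1)\<^sup>2 - 1) / 4"
    proof -
      have "2401/10000 * q \<le> (q - 2 * n + 1 - 1) / 4" if "1000 * n \<le> q" for q
        using that nk(2) by (simp add: field_simps)
      from this[OF nn] show ?thesis unfolding n1sq .
    qed
    also have "\<dots> \<le> \<rho>\<^sup>2" using Fb(1) rho by simp
    finally show "(49/100 * n)\<^sup>2 \<le> \<rho>\<^sup>2" .
  qed (use rho_pos in simp)
  have rho_hi: "\<rho> \<le> 505/1000 * n"
  proof (rule power2_le_imp_le)
    have "real D \<le> 2 * real F + 4 * real r"
      using of_nat_mono[OF edges_le[OF r x(1) AB nonbip], where ?'a = real] by (simp add: F_def)
    then have "2 * \<rho>\<^sup>2 \<le> 2 * real F + 4 * real r + real r * n"
      using rho_square_le_crude by (simp add: n_def)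
    moreover have "real r * n \<le> n / 1000 * n" using nk kdef by (intro mult_right_mono) auto
    moreover have "4 * real r \<le> n" using nk kdef by linarith
    ultimately have "2 * \<rho>\<^sup>2 \<le> (n - 1)\<^sup>2 / 2 + n + n / 1000 * n" using Fb(2) by linarith
    moreover have "n / 1000 * n = 1/1000 * (n * n)" by simp
    moreover have "y \<le> 255025/1000000 * q"
      if "1000 * n \<le> q" "2 * y \<le> (q - 2 * n + 1) / 2 + n + w" "w = 1/1000 * q" for q w y
      using that nk(2) by (simp add: field_simps)
    ultimately have "\<rho>\<^sup>2 \<le> 255025/1000000 * (n * n)" using nn n1sq by metis
    also have "\<dots> = (505/1000 * n)\<^sup>2" by (simp add: power2_eq_square)
    finally show "\<rho>\<^sup>2 \<le> (505/1000 * n)\<^sup>2" .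
  qed (use nk in simp)
  have gap: "\<rho>\<^sup>2 - a * b \<ge> 0" using abFr rho by linarith
  \<comment> \<open>Wherever the largest entry lies, the class \<open>A\<close> carries almost full weight; hence so does every
    vertex of \<open>B\<close> with few missing neighbours.\<close>
  have alpha: "\<alpha> \<ge> 47/100 * n" if small: "real (s + t) \<le> 3/10 * n"
  proof -
    have Nx: "card (N x) = s + t"
    proof -
      have "N x = (N x \<inter> A) \<union> (N x \<inter> B)" using ABD(1) N_sub[of x] N_irr[of x] by blast
      then have "card (N x) = card ((N x \<inter> A) \<union> (N x \<inter> B))" by (rule arg_cong[of _ _ card])
      also have "\<dots> = s + t" unfolding s_def t_def by (rule card_Un_disjoint) (use ABD in auto)
      finally show ?thesis .
    qed
    have "top_v \<noteq> x"
    proof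
      assume "top_v = x"
      then have "\<rho> \<le> real (s + t)" using rho_le_degree Nx by simp
      then show False using small rho_lo nk(2) by linarith
    qed
    then consider "top_v \<in> A" | "top_v \<in> B" using top_v(1) ABD(1) by blast
    then show ?thesis
    proof cases
      case 1
      have "\<rho> \<le> weight B + 1"
        using rho_z_class[OF x(1) AB 1] top_v(2) weight_nonneg[of "B - N top_v"] z_le_1[OF x(1)] by (auto split: if_splits)
      then have "\<rho> * (\<rho> - 1) \<le> \<rho> * weight B" using rho_pos by (intro mult_left_mono) auto
      also have "\<rho> * weight B \<le> b * \<alpha> + real t * z x"
        using rho_weight_class[OF x(1) AB[unfolded bipartition_sym[of _ A B]]] sum_nonneg[of B "\<lambda>u. weight (A - N u)"] weight_nonneg
        unfolding \<alpha>_def b_def t_def by simp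
      also have "real t * z x \<le> real t * 1" using z_le_1[OF x(1)] by (intro mult_left_mono) auto
      also have "real t \<le> 3/10 * n" using small by simp
      also have "b * \<alpha> \<le> 505/1000 * n * \<alpha>" using b(2) weight_nonneg[of A] unfolding \<alpha>_def by (intro mult_right_mono)
      finally have "\<rho> * (\<rho> - 1) \<le> 505/1000 * n * \<alpha> + 3/10 * n * 1" by simp
      moreover have "(49/100 * n) * (49/100 * n - 1) \<le> \<rho> * (\<rho> - 1)"
        using rho_lo nk(2) by (intro mult_mono) auto
      ultimately have "n * (2401/10000 * n - 49/100 - 3/10) \<le> n * (505/1000 * \<alpha>)"
        by (simp add: algebra_simps)
      then have "2401/10000 * n - 49/100 - 3/10 \<le> 505/1000 * \<alpha>" using nk(2) by (subst (asm) mult_le_cancel_left_pos) auto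
      then show ?thesis using nk(2) by linarith
    next
      case 2
      have "\<rho> \<le> weight A + 1"
        using rho_z_class[OF x(1) AB[unfolded bipartition_sym[of _ A B]] 2] top_v(2) weight_nonneg[of "A - N top_v"] z_le_1[OF x(1)]
        by (auto split: if_splits)
      then show ?thesis using rho_lo nk(2) by (simp add: \<alpha>_def)
    qed
  qed
  have zb: "z v \<ge> 9/10" if small: "real (s + t) \<le> 3/10 * n" and v: "v \<in> B" "real (card (A - N v)) \<le> 3 * k" for v
  proof -
    have "weight (A - N v) \<le> real (card (A - N v))" unfolding weight_def by (rule sum_z_le_card) (use ABD in auto)
    moreover have "\<rho> * z v \<ge> weight A - weight (A - N v)"
      using rho_z_class[OF x(1) AB[unfolded bipartition_sym[of _ A B]] v(1)] z_nonneg[of x] by (auto split: if_splits)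
    ultimately have "\<rho> * z v \<ge> 47/100 * n - 3 * k" using alpha[OF small] v(2) by (simp add: \<alpha>_def)
    moreover have "\<rho> * z v \<le> 505/1000 * n * z v" using rho_hi z_nonneg by (intro mult_right_mono)
    ultimately have "n * (467/1000) \<le> n * (505/1000 * z v)" using nk(3) by simp
    then show ?thesis using nk(2) by (subst (asm) mult_le_cancel_left_pos) auto
  qed
  have ineq: "(\<rho>\<^sup>2 - a * b) * \<alpha> \<le> 104/100 * (real (s + t))\<^sup>2 - \<rho> * M"
  proof -
    have zx: "\<rho> * z x \<le> real (s + t)" using rho_z_x_le[OF x(1) AB] by (simp add: s_def t_def)
    have "a * real t + \<rho> * real s \<le> 505/1000 * n * real t + 505/1000 * n * real s"
      using a rho_hi by (intro add_mono mult_right_mono) auto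
    then have "a * real t + \<rho> * real s \<le> 505/1000 * n * real (s + t)" by (simp add: algebra_simps)
    then have "(a * real t + \<rho> * real s) * z x \<le> 505/1000 * n * real (s + t) * z x"
      using z_nonneg by (intro mult_right_mono)
    also have "\<dots> = 505/490 * real (s + t) * (49/100 * n * z x)" by simp
    also have "\<dots> \<le> 505/490 * real (s + t) * real (s + t)"
    proof (intro mult_left_mono)
      have "49/100 * n * z x \<le> \<rho> * z x" using rho_lo z_nonneg by (intro mult_right_mono)
      then show "49/100 * n * z x \<le> real (s + t)" using zx by linarith
    qed auto
    also have "\<dots> \<le> 104/100 * (real (s + t))\<^sup>2"
      unfolding power2_eq_square mult.assoc by (intro mult_right_mono) auto
    finally show ?thesis
      using rho_square_identity[OF x(1) AB] unfolding a_def b_def \<alpha>_def M_def s_def t_def by linarith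
  qed
  have M_ge: "weight (B - N u) \<le> M" if "u \<in> A" for u
    unfolding M_def by (rule member_le_sum) (use that ABD weight_nonneg in auto)
  \<comment> \<open>Large \<open>t\<close> is excluded by passing to the case \<open>s = 1\<close>.\<close>
  have tK: "t \<le> K"
  proof (rule ccontr)
    assume "\<not> t \<le> K"
    then have tk: "t > 3 * r + 2 + C" by (simp add: K_def)
    have s1: "s = 1"
    proof (rule ccontr)
      assume "s \<noteq> 1"
      then have s2: "int s \<ge> 2" using st(1) by simp
      have "s * t \<le> m + r * s" using missing_lower[OF ABD(5,6), of x] by (simp add: s_def t_def m_def)
      then have "2 * (s * t) \<le> 2 * (s + t) + C + 2 * (r * s)" using mle by linarith
      then have "int (2 * (s * t)) \<le> int (2 * (s + t) + C + 2 * (r * s))" by (rule of_nat_mono)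
      then have "2 * (int s * int t) \<le> 2 * (int s + int t) + int C + 2 * (int r * int s)" by simp
      moreover define w where "w = int t - int r - 1"
      have "int s * w = int s * int t - int r * int s - int s" by (simp add: w_def algebra_simps)
      ultimately have "2 * (int s * w) \<le> 2 * int t + int C" by (simp add: algebra_simps)
      moreover have "2 * w \<le> int s * w" using s2 tk by (intro mult_right_mono) (auto simp: w_def)
      ultimately have "4 * w \<le> 2 * int t + int C" by linarith
      then show False using tk unfolding w_def by simp
    qed
    then obtain v where v: "N x \<inter> A = {v}" unfolding s_def by (meson card_1_singletonE)
    then have vA: "v \<in> A" "v \<in> N x" by auto
    have vV: "v \<in> V" using vA ABD by auto
    define T' where "T' = N v \<inter> B"
    have dv: "card (N v) = card T' + 1"
    proof -
      have "N v = T' \<union> {x}" using nbhd_class[OF x(1) AB vA(1)] vA(2) by (simp add: T'_def)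
      moreover have "x \<notin> T'" using ABD by (simp add: T'_def)
      moreover have "finite T'" by (simp add: T'_def)
      ultimately show ?thesis by simp
    qed
    have dx: "card (N x) = t + 1"
    proof -
      have "N x = (N x \<inter> B) \<union> {v}" using v ABD(1) N_sub[of x] N_irr[of x] by blast
      moreover have "v \<notin> N x \<inter> B" using vA ABD(2) by auto
      ultimately have "card (N x) = card (N x \<inter> B) + 1" by (metis Suc_eq_plus1 Un_insert_right card_insert_disjoint fin_N finite_Int sup_bot_right)
      then show ?thesis by (simp add: t_def)
    qed
    have "bipartition (V - {v}) (insert x (A - {v})) B"
    proof -
      have "indep (insert x (A - {v}))"
        using ABD(3) v N_sym N_irr unfolding indep_def by blast
      then show ?thesis using ABD x(1) vA vV by (auto simp: bipartition_def)
    qed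
    then have "t \<le> card T'" using min[OF vV] dv dx by auto
    moreover have "card T' + t \<le> card B + r"
      using adjacent_degree_sum[of v x B] vA ABD(6) by (simp add: T'_def t_def)
    ultimately have "2 * t \<le> card B + r" by linarith
    then have "2 * real t \<le> b + real r" unfolding b_def by linarith
    then have t1: "real t + 1 \<le> 261/1000 * n" using b(2) nk kdef k0 by linarith
    then have small: "real (s + t) \<le> 3/10 * n" using s1 nk by simp
    \<comment> \<open>The pairs of \<open>v\<close> with \<open>Y\<close> are missing; all others are boundedly many, so \<open>z\<close> is close to \<open>1\<close> on \<open>Y\<close>.\<close>
    define Y where "Y = N x \<inter> B - N v"
    have Y: "t \<le> r + card Y" using missing_at_neighbour[OF vA(2) ABD(6)] by (simp add: Y_def t_def)
    have msplit: "m = card (B - N v) + missing (A - {v}) B"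
      unfolding m_def missing_def using vA(1) ABD(5) by (simp add: sum.remove)
    have "card Y \<le> card (B - N v)" unfolding Y_def using ABD by (intro card_mono) auto
    then have rest: "2 * missing (A - {v}) B \<le> 2 + 2 * r + C" using msplit Y mle' s1 by linarith
    have zY: "z y \<ge> 9/10" if "y \<in> Y" for y
    proof -
      have "y \<in> B" using that by (simp add: Y_def)
      have "card (A - N y) \<le> card (insert v (A - {v} - N y))" using ABD by (intro card_mono) auto
      also have "\<dots> \<le> Suc (card (A - {v} - N y))" by (rule card_insert_le_m1) auto
      also have "card (A - {v} - N y) \<le> missing (A - {v}) B"
        by (rule missing_le_at) (use ABD \<open>y \<in> B\<close> in auto)
      finally have "card (A - N y) \<le> 3 * K" using rest by (simp add: K_def)
      then have "real (card (A - N y)) \<le> 3 * k" unfolding k_def by linarith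
      then show ?thesis by (rule zb[OF small \<open>y \<in> B\<close>])
    qed
    have "9/10 * (real t - real r) \<le> 9/10 * real (card Y)" using Y by simp
    also have "\<dots> \<le> weight Y" unfolding weight_def using sum_bounded_below[of Y "9/10" z] zY by (simp add: mult.commute)
    also have "\<dots> \<le> weight (B - N v)" unfolding weight_def Y_def using ABD z_nonneg by (intro sum_mono2) auto
    also have "\<dots> \<le> M" by (rule M_ge[OF vA(1)])
    finally have M: "9/10 * (real t - real r) \<le> M" .
    have tr: "real t > 3 * real r + 2" using tk by linarith
    define g h where "g = real t - real r" and "h = real t + 1"
    have "49/100 * n * (9/10 * g) \<le> \<rho> * M"
      using M rho_lo nk tr unfolding g_def by (intro mult_mono) auto
    then have "441/1000 * (n * g) \<le> \<rho> * M" by simp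
    moreover have "0 \<le> (\<rho>\<^sup>2 - a * b) * \<alpha>" using gap alpha[OF small] nk by simp
    moreover have "(real (s + t))\<^sup>2 \<le> (261/1000 * n) * h"
      unfolding power2_eq_square s1 h_def using t1 by (intro mult_mono) auto
    then have "(real (s + t))\<^sup>2 \<le> 261/1000 * (n * h)" by simp
    ultimately have "441/1000 * (n * g) \<le> 104/100 * (261/1000 * (n * h))"
      using ineq by linarith
    then have "n * (441/1000 * g) \<le> n * (104/100 * (261/1000 * h))" by simp
    then have "441/1000 * g \<le> 104/100 * (261/1000 * h)"
      using nk(2) by (subst (asm) mult_le_cancel_left_pos) auto
    then show False using tr k0 by (simp add: g_def h_def)
  qed
  have stk: "real (s + t) \<le> 2 * k" using tK st(3) unfolding k_def by linarith
  then have small: "real (s + t) \<le> 3/10 * n" using nk by linarith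
  have "(real (s + t))\<^sup>2 \<le> (2 * k)\<^sup>2" using stk by (intro power_mono) auto
  then have st2: "(real (s + t))\<^sup>2 \<le> 4/1000 * n" using nk(1) by (simp add: power2_eq_square)
  have al: "\<alpha> \<ge> 47/100 * n" by (rule alpha[OF small])
  have zB: "z v \<ge> 9/10" if "v \<in> B" for v
  proof (rule zb[OF small that])
    have "card (A - N v) \<le> m" unfolding m_def by (rule missing_le_at) (use ABD that in auto)
    then have "2 * card (A - N v) \<le> 4 * K + C" using mle' tK st(3) by linarith
    then have "card (A - N v) \<le> 3 * K" by (simp add: K_def)
    then show "real (card (A - N v)) \<le> 3 * k" unfolding k_def by linarith
  qed
  have m0: "m = 0"
  proof (rule ccontr)
    assume "m \<noteq> 0"
    then obtain u where u: "u \<in> A" "card (B - N u) \<noteq> 0" unfolding m_def missing_def by (meson sum.neutral)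
    then obtain y where y: "y \<in> B - N u" by (metis card.empty ex_in_conv)
    have "z y \<le> weight (B - N u)" unfolding weight_def by (rule member_le_sum) (use y ABD z_nonneg in auto)
    then have "9/10 \<le> M" using M_ge[OF u(1)] zB[of y] y by auto
    then have "49/100 * n * (9/10) \<le> \<rho> * M" using rho_lo nk by (intro mult_mono) auto
    moreover have "0 \<le> (\<rho>\<^sup>2 - a * b) * \<alpha>" using gap al nk by simp
    ultimately show False using ineq st2 nk by simp
  qed
  have "card A * card B = F"
  proof (rule ccontr)
    assume "card A * card B \<noteq> F"
    then have "card A * card B + 1 \<le> F" using abF by simp
    then have "a * b + 1 \<le> real F" using of_nat_mono[of "card A * card B + 1" F, where ?'a = real] by (simp add: a_def b_def)
    then have "1 \<le> \<rho>\<^sup>2 - a * b" using rho by linarith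
    then have "1 * (47/100 * n) \<le> (\<rho>\<^sup>2 - a * b) * \<alpha>" using al nk by (intro mult_mono) auto
    moreover have "\<rho> * M \<ge> 0" using rho_pos weight_nonneg unfolding M_def by (simp add: sum_nonneg)
    ultimately show False using ineq st2 nk by simp
  qed
  moreover have "\<forall>b\<in>B. z b > 0" using zB by fastforce
  ultimately show ?thesis using x(1) AB m0 sle unfolding m_def by blast
qed

end

section \<open>From graphs to neighbourhood functions and back\<close>

definition nbhd :: "nat pair_pre_digraph \<Rightarrow> nat \<Rightarrow> nat set" where
  "nbhd G u = {v. (u, v) \<in> parcs G}"

definition graph_of_nbhd :: "nat \<Rightarrow> (nat \<Rightarrow> nat set) \<Rightarrow> nat pair_pre_digraph" where
  "graph_of_nbhd n N = \<lparr>pverts = {0..<n}, parcs = {(u, v). v \<in> N u}\<rparr>"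

lemma simple_graph_nbhd:
  assumes "G \<in> graphs_on n"
  shows "simple_graph {0..<n} (nbhd G)"
proof -
  interpret pair_graph G using assms by (simp add: graphs_on_def)
  have V: "pverts G = {0..<n}" using assms by (simp add: graphs_on_def)
  show ?thesis
  proof
    show "nbhd G u \<subseteq> {0..<n}" for u using in_arcsD2 V by (auto simp: nbhd_def)
    show "u \<in> nbhd G v" if "v \<in> nbhd G u" for u v using that arcs_symmetric by (auto simp: nbhd_def)
    show "u \<notin> nbhd G u" for u using pair_no_loops[of "(u, u)"] by (auto simp: nbhd_def)
  qed simp
qed

lemma graph_of_nbhd_in_graphs_on:
  assumes "simple_graph {0..<n} N"
  shows "graph_of_nbhd n N \<in> graphs_on n" "nbhd (graph_of_nbhd n N) = N"
proof -
  interpret simple_graph "{0..<n}" N by fact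
  have mem: "u < n" "v < n" if "v \<in> N u" for u v
    using that N_sub[of u] N_sub[of v] N_sym[OF that] by auto
  have fin: "finite {(u, v). v \<in> N u}"
    by (rule finite_subset[of _ "{0..<n} \<times> {0..<n}"]) (use mem in auto)
  have "pair_graph (graph_of_nbhd n N)"
    using mem N_sym N_irr fin
    by unfold_locales (auto simp: graph_of_nbhd_def symmetric_def sym_def)
  then show "graph_of_nbhd n N \<in> graphs_on n" by (simp add: graphs_on_def graph_of_nbhd_def)
  show "nbhd (graph_of_nbhd n N) = N" by (auto simp: nbhd_def graph_of_nbhd_def)
qed

lemma double_num_edges:
  assumes G: "G \<in> graphs_on n"
  shows "2 * num_edges G = (\<Sum>u\<in>{0..<n}. card (nbhd G u))"
proof -
  interpret simple_graph "{0..<n}" "nbhd G" by (rule simple_graph_nbhd[OF G])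
  define P where "P = {(u, v). v \<in> nbhd G u \<and> u < v}"
  have arcs: "parcs G = Sigma {0..<n} (nbhd G)"
    using N_sub N_sym by (auto simp: nbhd_def)
  then have fin: "finite (parcs G)" by simp
  have "(u, v) \<in> parcs G \<longleftrightarrow> (u, v) \<in> P \<union> P\<inverse>" for u v
    using N_sym[of u v] N_sym[of v u] N_irr[of u] by (cases u v rule: linorder_cases) (auto simp: P_def nbhd_def)
  then have un: "parcs G = P \<union> P\<inverse>" by (auto simp only: set_eq_iff split_paired_All)
  have dis: "P \<inter> P\<inverse> = {}" by (auto simp: P_def)
  have finP: "finite P" using fin un by simp
  have "(\<lambda>(u, v). {u, v}) ` parcs G = (\<lambda>(u, v). {u, v}) ` P"
    unfolding un image_Un by force
  moreover have "inj_on (\<lambda>(u, v). {u, v}) P"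
    by (auto simp: inj_on_def P_def doubleton_eq_iff)
  ultimately have "num_edges G = card P"
    by (simp add: num_edges_def card_image)
  moreover have "card (parcs G) = card P + card (P\<inverse>)"
    unfolding un by (rule card_Un_disjoint) (use finP dis in auto)
  moreover have "card (parcs G) = (\<Sum>u\<in>{0..<n}. card (nbhd G u))"
    unfolding arcs by (rule card_SigmaI) auto
  ultimately show ?thesis by simp
qed

lemma bipartite_iff:
  assumes G: "G \<in> graphs_on n"
  shows "bipartite G \<longleftrightarrow> (\<exists>A B. simple_graph.bipartition (nbhd G) {0..<n} A B)"
proof -
  interpret simple_graph "{0..<n}" "nbhd G" by (rule simple_graph_nbhd[OF G])
  have V: "pverts G = {0..<n}" using G by (simp add: graphs_on_def)
  have *: "(\<forall>(u, v)\<in>parcs G. (u \<in> A \<and> v \<in> B) \<or> (u \<in> B \<and> v \<in> A)) \<longleftrightarrow> indep A \<and> indep B"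
    if "{0..<n} = A \<union> B" "A \<inter> B = {}" for A B
  proof
    assume "\<forall>(u, v)\<in>parcs G. (u \<in> A \<and> v \<in> B) \<or> (u \<in> B \<and> v \<in> A)"
    then show "indep A \<and> indep B" using that(2) by (fastforce simp: indep_def nbhd_def)
  next
    assume i: "indep A \<and> indep B"
    show "\<forall>(u, v)\<in>parcs G. (u \<in> A \<and> v \<in> B) \<or> (u \<in> B \<and> v \<in> A)"
    proof clarify
      fix u v assume "(u, v) \<in> parcs G" "\<not> (u \<in> B \<and> v \<in> A)"
      moreover from this have v: "v \<in> nbhd G u" by (simp add: nbhd_def)
      moreover from v have "u \<in> A \<union> B" "v \<in> A \<union> B" using N_sub[of u] N_sub[of v] N_sym[of v u] that(1) by blast+
      ultimately show "u \<in> A \<and> v \<in> B" using i unfolding indep_def by blast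
    qed
  qed
  show ?thesis
    unfolding bipartite_def V bipartition_def eq_commute[where b = "{0..<n}"]
    by (intro ex_cong1 conj_cong refl *)
qed

lemma pverts_book: "pverts (book (r + 1)) = {0..<r + 3}"
  by (simp add: book_def Let_def eval_nat_numeral)

lemma parcs_book: "(a, b) \<in> parcs (book (r + 1)) \<longleftrightarrow>
    a = 0 \<and> b = 1 \<or> a = 1 \<and> b = 0 \<or> a < 2 \<and> b \<in> {2..<r + 3} \<or> b < 2 \<and> a \<in> {2..<r + 3}"
proof -
  have two: "c = 0 \<or> c = Suc 0 \<longleftrightarrow> c < 2" for c :: nat by auto
  show ?thesis by (simp add: book_def Let_def two) (auto simp: eval_nat_numeral)
qed

text \<open>
  An embedded book sends its spine to an edge and its pages to \<open>r + 1\<close> common neighbours of the ends.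
\<close>

lemma free_of_book_if_codegree_le:
  assumes G: "G \<in> graphs_on n" and codeg: "\<And>u v. v \<in> nbhd G u \<Longrightarrow> card (nbhd G u \<inter> nbhd G v) \<le> r"
  shows "free_of (book (r + 1)) G"
  unfolding free_of_def
proof (intro notI, elim exE conjE)
  fix K :: "nat pair_pre_digraph"
  assume sub: "subgraph (with_proj K) (with_proj G)" and iso: "digraph_iso (with_proj (book (r + 1))) (with_proj K)"
  interpret simple_graph "{0..<n}" "nbhd G" by (rule simple_graph_nbhd[OF G])
  obtain f where f: "pre_digraph.digraph_isomorphism (with_proj (book (r + 1))) f"
    and K: "with_proj K = app_iso f (with_proj (book (r + 1)))"
    using iso by (auto simp: digraph_iso_def)
  define \<phi> where "\<phi> = iso_verts f"
  have inj: "inj_on \<phi> {0..<r + 3}"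
    using f pverts_book[of r] by (simp add: pre_digraph.digraph_isomorphism_def \<phi>_def)
  have tl: "iso_tail f = fst" "iso_head f = snd" "parcs K = iso_arcs f ` parcs (book (r + 1))"
    using arg_cong[OF K, of tail] arg_cong[OF K, of head] arg_cong[OF K, of arcs] by simp_all
  have arc: "(\<phi> a, \<phi> b) \<in> parcs G" if "(a, b) \<in> parcs (book (r + 1))" for a b
  proof -
    have "\<phi> a = fst (iso_arcs f (a, b))" "\<phi> b = snd (iso_arcs f (a, b))"
      using f that tl by (auto simp: pre_digraph.digraph_isomorphism_def \<phi>_def)
    then have "(\<phi> a, \<phi> b) \<in> parcs K" using that tl by simp
    then show ?thesis using sub by (auto simp: subgraph_def)
  qed
  have "\<phi> 1 \<in> nbhd G (\<phi> 0)" using arc[of 0 1] by (simp add: nbhd_def book_def)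
  then have "card (nbhd G (\<phi> 0) \<inter> nbhd G (\<phi> 1)) \<le> r" by (rule codeg)
  moreover have "\<phi> ` {2..<r + 3} \<subseteq> nbhd G (\<phi> 0) \<inter> nbhd G (\<phi> 1)"
    using arc by (auto simp: nbhd_def book_def Let_def)
  then have "card (\<phi> ` {2..<r + 3}) \<le> card (nbhd G (\<phi> 0) \<inter> nbhd G (\<phi> 1))"
    by (intro card_mono) auto
  moreover have "card (\<phi> ` {2..<r + 3}) = r + 1"
    by (subst card_image) (auto intro: inj_on_subset[OF inj])
  ultimately show False by simp
qed

text \<open>
  Conversely, \<open>r + 1\<close> common neighbours of the ends \<open>u\<close>, \<open>v\<close> of an edge span a book: the map \<open>\<phi>\<close>
  sends the spine \<open>{0, 1}\<close> to \<open>u\<close>, \<open>v\<close> and the pages injectively to the common neighbours, and the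
  image of the book under \<open>\<phi>\<close> is the required subgraph.
\<close>

lemma codegree_le_if_free_of_book:
  assumes G: "G \<in> graphs_on n" and free: "free_of (book (r + 1)) G" and uv: "v \<in> nbhd G u"
  shows "card (nbhd G u \<inter> nbhd G v) \<le> r"
proof (rule ccontr)
  assume neg: "\<not> card (nbhd G u \<inter> nbhd G v) \<le> r"
  interpret simple_graph "{0..<n}" "nbhd G" by (rule simple_graph_nbhd[OF G])
  interpret pg: pair_graph G using G by (simp add: graphs_on_def)
  have V: "pverts G = {0..<n}" using G by (simp add: graphs_on_def)
  have "card {2..<r + 3} \<le> card (nbhd G u \<inter> nbhd G v)" using neg by simp
  then obtain h where h: "h ` {2..<r + 3} \<subseteq> nbhd G u \<inter> nbhd G v" "inj_on h {2..<r + 3}"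
    using card_le_inj[of "{2..<r + 3}" "nbhd G u \<inter> nbhd G v"] by auto
  define \<phi> where "\<phi> i = (if i = 0 then u else if i = 1 then v else h i)" for i :: nat
  have uvh: "h i \<noteq> u" "h i \<noteq> v" "h i \<in> nbhd G u" "h i \<in> nbhd G v" if "2 \<le> i" "i < r + 3" for i
    using h(1) that N_irr by fastforce+
  have vu: "v \<noteq> u" using uv N_irr by auto
  have inj: "inj_on \<phi> {0..<r + 3}"
  proof -
    have im: "\<phi> ` {2..<r + 3} = h ` {2..<r + 3}"
      by (rule image_cong) (auto simp: \<phi>_def)
    have "u \<notin> h ` {2..<r + 3}" "v \<notin> h ` {2..<r + 3}" using h(1) N_irr by blast+
    moreover have "inj_on \<phi> {2..<r + 3} \<longleftrightarrow> inj_on h {2..<r + 3}"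
      by (rule inj_on_cong) (auto simp: \<phi>_def)
    moreover have "\<phi> 0 = u" "\<phi> 1 = v" by (simp_all add: \<phi>_def)
    ultimately have "inj_on \<phi> (insert 0 (insert 1 {2..<r + 3}))"
      using h(2) vu im by simp
    moreover have "{0..<r + 3} = insert 0 (insert 1 {2..<r + 3})" by auto
    ultimately show ?thesis by simp
  qed
  have arc: "\<phi> b \<in> nbhd G (\<phi> a)" if ab: "(a, b) \<in> parcs (book (r + 1))" for a b
  proof -
    have page: "h i \<in> nbhd G (\<phi> c)" if "c < 2" "i \<in> {2..<r + 3}" for c i
      using uvh[of i] that by (auto simp: \<phi>_def)
    consider "a = 0" "b = 1" | "a = 1" "b = 0" | "a < 2" "b \<in> {2..<r + 3}" | "b < 2" "a \<in> {2..<r + 3}"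
      using ab unfolding parcs_book by blast
    then show ?thesis
    proof cases
      case 1
      then show ?thesis using uv by (simp add: \<phi>_def)
    next
      case 2
      then show ?thesis using N_sym[OF uv] by (simp add: \<phi>_def)
    next
      case 3
      then show ?thesis using page[OF 3] by (simp add: \<phi>_def)
    next
      case 4
      then show ?thesis using N_sym[OF page[OF 4]] by (simp add: \<phi>_def)
    qed
  qed
  have bookV: "a < r + 3" "b < r + 3" if "(a, b) \<in> parcs (book (r + 1))" for a b
    using that unfolding parcs_book by auto
  define K where "K = \<lparr>pverts = \<phi> ` {0..<r + 3}, parcs = map_prod \<phi> \<phi> ` parcs (book (r + 1))\<rparr>"
  have Ksub: "parcs K \<subseteq> parcs G" using arc by (auto simp: K_def nbhd_def)
  have "pverts K \<subseteq> pverts G"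
  proof -
    have "u \<in> {0..<n}" "v \<in> {0..<n}" using uv N_sub N_sym by blast+
    moreover have "h i \<in> {0..<n}" if "2 \<le> i" "i < r + 3" for i
      using uvh(3)[OF that] N_sub[of u] by blast
    ultimately have "\<phi> i \<in> {0..<n}" if "i < r + 3" for i using that by (simp add: \<phi>_def)
    then show ?thesis unfolding V by (auto simp: K_def)
  qed
  moreover have "wf_digraph (with_proj K)"
    by unfold_locales (auto simp: K_def intro!: imageI dest: bookV[simplified])
  ultimately have "subgraph (with_proj K) (with_proj G)"
    using Ksub by (auto simp: subgraph_def compatible_def) unfold_locales
  moreover have "digraph_iso (with_proj (book (r + 1))) (with_proj K)"
    unfolding digraph_iso_def
  proof (intro exI conjI)
    let ?f = "\<lparr>iso_verts = \<phi>, iso_arcs = map_prod \<phi> \<phi>, iso_head = snd, iso_tail = fst\<rparr>"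
    have "wf_digraph (with_proj (book (r + 1)))"
      by unfold_locales (auto simp: book_def Let_def)
    moreover have "inj_on (map_prod \<phi> \<phi>) (parcs (book (r + 1)))"
      by (rule inj_on_subset[OF map_prod_inj_on[OF inj inj]]) (use bookV in auto)
    ultimately show "pre_digraph.digraph_isomorphism (with_proj (book (r + 1))) ?f"
      using inj pverts_book[of r] by (simp add: pre_digraph.digraph_isomorphism_def)
    show "with_proj K = app_iso ?f (with_proj (book (r + 1)))"
      using pverts_book[of r] by (simp add: app_iso_def with_proj_def K_def)
  qed
  ultimately show False using free by (auto simp: free_of_def)
qed

lemma nonbipartite_free_iff:
  assumes G: "G \<in> graphs_on n"
  shows "G \<in> nonbipartite_free n (book (r + 1)) \<longleftrightarrow>
    book_free_graph {0..<n} (nbhd G) r \<and> (\<nexists>A B. simple_graph.bipartition (nbhd G) {0..<n} A B)"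
  using G simple_graph_nbhd[OF G] bipartite_iff[OF G] free_of_book_if_codegree_le[OF G, of r] codegree_le_if_free_of_book[OF G, of r]
  unfolding nonbipartite_free_def book_free_graph_def book_free_graph_axioms_def by blast

lemma sum_adjacency:
  assumes "simple_graph {0..<n} (nbhd G)"
  shows "(\<Sum>j<n. (if (i, j) \<in> parcs G then 1 else 0) * (f j :: real)) = (\<Sum>j\<in>nbhd G i. f j)"
proof -
  interpret simple_graph "{0..<n}" "nbhd G" by fact
  have "(\<Sum>j<n. (if (i, j) \<in> parcs G then 1 else 0) * f j) = (\<Sum>j\<in>{..<n}. if j \<in> nbhd G i then f j else 0)"
    by (intro sum.cong refl) (auto simp: nbhd_def)
  also have "\<dots> = (\<Sum>j\<in>{..<n} \<inter> nbhd G i. f j)" by (simp add: sum.inter_restrict)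
  also have "{..<n} \<inter> nbhd G i = nbhd G i" using N_sub[of i] by (auto simp: subset_iff)
  finally show ?thesis .
qed

lemma rayleigh_le_graph_spectral_radius:
  assumes G: "G \<in> graphs_on n" and n: "n \<ge> 1"
  shows "(\<Sum>i\<in>{0..<n}. f i * (\<Sum>j\<in>nbhd G i. f j)) \<le> graph_spectral_radius G * (\<Sum>i\<in>{0..<n}. (f i)\<^sup>2)"
proof -
  have "bilin n (\<lambda>i j. if (i, j) \<in> parcs G then 1 else 0) f f
    = (\<Sum>i<n. f i * (\<Sum>j<n. (if (i, j) \<in> parcs G then 1 else 0) * f j))"
    by (simp add: bilin_def sum_distrib_left mult.assoc)
  then show ?thesis
    using graph_spectral_radius_props(2)[OF G n, of f] sum_adjacency[OF simple_graph_nbhd[OF G]]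
    by (simp add: lessThan_atLeast0)
qed

lemma ex_perron_vector:
  assumes G: "G \<in> graphs_on n" and n: "n \<ge> 1"
  shows "\<exists>z u. (\<forall>v. z v \<ge> 0) \<and> (\<forall>v\<in>{0..<n}. z v \<le> 1) \<and> u \<in> {0..<n} \<and> z u = 1
    \<and> (\<forall>v\<in>{0..<n}. (\<Sum>w\<in>nbhd G v. z w) = graph_spectral_radius G * z v)"
proof -
  obtain y where y: "\<And>i. y i \<ge> 0" "(\<Sum>i<n. (y i)\<^sup>2) = 1"
    "\<And>i. i < n \<Longrightarrow> (\<Sum>j\<in>nbhd G i. y j) = graph_spectral_radius G * y i"
    using graph_spectral_radius_props(1)[OF G n] unfolding sum_adjacency[OF simple_graph_nbhd[OF G]] by blast
  define m where "m = Max (y ` {0..<n})"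
  have "m \<in> y ` {0..<n}" unfolding m_def using n by (intro Max_in) auto
  then obtain u where u: "u \<in> {0..<n}" "y u = m" by auto
  have le: "y v \<le> m" if "v \<in> {0..<n}" for v unfolding m_def using that by simp
  have "m \<noteq> 0"
  proof
    assume "m = 0"
    then have "y v = 0" if "v < n" for v using le[of v] y(1)[of v] that by simp
    then show False using y(2) by simp
  qed
  then have m: "m > 0" using y(1)[of u] u by simp
  define z where "z v = y v / m" for v
  have "(\<Sum>w\<in>nbhd G v. z w) = graph_spectral_radius G * z v" if "v \<in> {0..<n}" for v
    using y(3)[of v] that by (simp add: z_def flip: sum_divide_distrib)
  moreover have "z v \<ge> 0" for v using y(1) m by (simp add: z_def)
  moreover have "z v \<le> 1" if "v \<in> {0..<n}" for v using le[OF that] m by (simp add: z_def)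
  moreover have "z u = 1" using u m by (simp add: z_def)
  ultimately show ?thesis using u(1) by blast
qed

text \<open>
  The Rayleigh quotient is evaluated at the Perron vector of the complete bipartite graph on \<open>A\<close>, \<open>B\<close>,
  extended by \<open>0\<close> at \<open>x\<close>.
\<close>

lemma complete_bipartite_spectral_radius:
  assumes G: "G \<in> graphs_on n" and x: "x < n"
    and classes: "simple_graph.bipartition (nbhd G) ({0..<n} - {x}) A B" and complete: "\<And>u. u \<in> A \<Longrightarrow> B \<subseteq> nbhd G u"
  shows "sqrt (real (card A * card B)) \<le> graph_spectral_radius G"
proof (cases "card A * card B = 0")
  case True
  obtain z u where z: "\<And>v. z v \<ge> (0::real)" "u \<in> {0..<n}" "z u = 1"
    "\<And>v. v \<in> {0..<n} \<Longrightarrow> (\<Sum>w\<in>nbhd G v. z w) = graph_spectral_radius G * z v"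
    using ex_perron_vector[OF G] x by force
  have "0 \<le> (\<Sum>w\<in>nbhd G u. z w)" using z(1) by (intro sum_nonneg)
  then have "0 \<le> graph_spectral_radius G" using z(3) z(4)[OF z(2)] by simp
  then show ?thesis unfolding True by simp
next
  case False
  interpret simple_graph "{0..<n}" "nbhd G" by (rule simple_graph_nbhd[OF G])
  have AB: "A \<union> B = {0..<n} - {x}" "A \<inter> B = {}" using classes by (auto simp: bipartition_def)
  have fin: "finite A" "finite B" using AB by (metis finite_Diff finite_Un finite_atLeastLessThan)+
  define a b where "a = real (card A)" and "b = real (card B)"
  have ab: "a * b > 0" using False by (simp add: a_def b_def)
  define f where "f i = (if i \<in> A then sqrt b else if i \<in> B then sqrt a else 0)" for i
  have f0: "f i \<ge> 0" for i by (simp add: f_def a_def b_def)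
  have fA: "f i = sqrt b" if "i \<in> A" for i using that by (simp add: f_def)
  have fB: "f i = sqrt a" if "i \<in> B" for i using that AB by (auto simp: f_def)
  have complete': "A \<subseteq> nbhd G v" if "v \<in> B" for v using complete N_sym that by blast
  have split: "(\<Sum>i\<in>{0..<n}. g i) = (\<Sum>i\<in>A. g i) + (\<Sum>i\<in>B. g i) + g x" for g :: "nat \<Rightarrow> real"
  proof -
    have "{0..<n} = insert x (A \<union> B)" "x \<notin> A \<union> B" using AB x by auto
    then show ?thesis using fin AB(2) by (simp add: sum.union_disjoint)
  qed
  have sq: "(\<Sum>i\<in>{0..<n}. (f i)\<^sup>2) = 2 * (a * b)"
  proof -
    have "x \<notin> A" "x \<notin> B" using AB by auto
    then show ?thesis unfolding split by (simp add: fA fB f_def[of x] a_def b_def cong: sum.cong)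
  qed
  have s: "sqrt a * sqrt a = a" "sqrt b * sqrt b = b" by (simp_all add: a_def b_def)
  have "(\<Sum>i\<in>A. f i * (\<Sum>j\<in>nbhd G i. f j)) \<ge> (\<Sum>i\<in>A. sqrt b * (b * sqrt a))"
  proof (intro sum_mono)
    fix i assume i: "i \<in> A"
    have "b * sqrt a = (\<Sum>j\<in>B. f j)" by (simp add: fB b_def)
    also have "\<dots> \<le> (\<Sum>j\<in>nbhd G i. f j)" using complete[OF i] f0 by (intro sum_mono2) auto
    finally show "sqrt b * (b * sqrt a) \<le> f i * (\<Sum>j\<in>nbhd G i. f j)"
      unfolding fA[OF i] by (intro mult_left_mono) (auto simp: b_def)
  qed
  moreover have "(\<Sum>i\<in>B. f i * (\<Sum>j\<in>nbhd G i. f j)) \<ge> (\<Sum>i\<in>B. sqrt a * (a * sqrt b))"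
  proof (intro sum_mono)
    fix i assume i: "i \<in> B"
    have "a * sqrt b = (\<Sum>j\<in>A. f j)" by (simp add: fA a_def)
    also have "\<dots> \<le> (\<Sum>j\<in>nbhd G i. f j)" using complete'[OF i] f0 by (intro sum_mono2) auto
    finally show "sqrt a * (a * sqrt b) \<le> f i * (\<Sum>j\<in>nbhd G i. f j)"
      unfolding fB[OF i] by (intro mult_left_mono) (auto simp: a_def)
  qed
  moreover have "(\<Sum>i\<in>A. sqrt b * (b * sqrt a)) + (\<Sum>i\<in>B. sqrt a * (a * sqrt b)) = sqrt (a * b) * (2 * (a * b))"
    by (simp add: real_sqrt_mult a_def b_def)
  moreover have "f x * (\<Sum>j\<in>nbhd G x. f j) \<ge> 0" using f0 by (simp add: sum_nonneg)
  ultimately have "sqrt (a * b) * (2 * (a * b)) \<le> (\<Sum>i\<in>{0..<n}. f i * (\<Sum>j\<in>nbhd G i. f j))"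
    unfolding split by linarith
  also have "\<dots> \<le> graph_spectral_radius G * (2 * (a * b))"
    using rayleigh_le_graph_spectral_radius[OF G, of f] x unfolding sq by simp
  finally have "sqrt (a * b) \<le> graph_spectral_radius G"
    by (rule mult_right_le_imp_le) (use ab in simp)
  then show ?thesis by (simp add: a_def b_def)
qed

context simple_graph
begin

text \<open>
  Common neighbours of \<open>x\<close> and a vertex of one class are neighbours of \<open>x\<close> in the other class; a cross
  pair has no common neighbour besides \<open>x\<close>. Neighbours of \<open>x\<close> in the two classes close a triangle.
\<close>

lemma complete_plus_vertex:
  assumes x: "x \<in> V" and classes: "bipartition (V - {x}) A B" and complete: "\<And>u. u \<in> A \<Longrightarrow> B \<subseteq> N u"
    and s: "N x \<inter> A \<noteq> {}" "card (N x \<inter> A) \<le> r" and t: "N x \<inter> B \<noteq> {}" "card (N x \<inter> B) \<le> r"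
  shows "book_free_graph V N r" and "\<nexists>P Q. bipartition V P Q"
proof -
  have AB: "A \<union> B = V - {x}" "A \<inter> B = {}" "indep A" "indep B" using classes by (auto simp: bipartition_def)
  have r: "r \<ge> 1" using s by (metis One_nat_def Suc_leI card_gt_0_iff finite_Int fin_N order_less_le_trans)
  have codeg_at_x: "card (N x \<inter> N v) \<le> r" if v: "v \<in> N x" for v
  proof -
    have "v \<in> A \<union> B" using v N_sub[of x] N_irr[of x] AB by auto
    then have "N v \<inter> A = {} \<or> N v \<inter> B = {}" using AB(3,4) by (auto simp only: indep_def)
    moreover have "N x \<subseteq> A \<union> B" using N_sub[of x] N_irr[of x] AB(1) by auto
    ultimately have "N x \<inter> N v \<subseteq> N x \<inter> A \<or> N x \<inter> N v \<subseteq> N x \<inter> B" by blast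
    then show ?thesis using s(2) t(2) by (meson card_mono fin_N finite_Int le_trans)
  qed
  have codeg_off_x: "card (N u \<inter> N v) \<le> r" if "v \<in> N u" "u \<noteq> x" "v \<noteq> x" for u v
  proof -
    have "u \<in> A \<union> B" "v \<in> A \<union> B" using that N_sub[of u] N_sub[of v] N_sym[of v u] AB by auto
    then have "N u \<inter> N v \<subseteq> {x}"
      using AB that N_sub[of u] unfolding indep_def by blast
    then have "card (N u \<inter> N v) \<le> card {x}" by (intro card_mono) auto
    then show ?thesis using r by simp
  qed
  show "book_free_graph V N r"
  proof
    fix u v assume v: "v \<in> N u"
    show "card (N u \<inter> N v) \<le> r"
    proof (cases "u = x \<or> v = x")
      case True
      then show ?thesis using codeg_at_x[of v] codeg_at_x[of u] v N_sym[OF v] by (auto simp: Int_commute)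
    qed (use codeg_off_x v in auto)
  qed
  show "\<nexists>P Q. bipartition V P Q"
  proof
    assume "\<exists>P Q. bipartition V P Q"
    then obtain P Q where PQ: "P \<union> Q = V" "indep P" "indep Q" by (auto simp: bipartition_def)
    obtain p q where pq: "p \<in> N x" "p \<in> A" "q \<in> N x" "q \<in> B" using s t by blast
    then have "q \<in> N p" using complete by blast
    then show False using PQ pq x N_sub unfolding indep_def by blast
  qed
qed

end

text \<open>
  The witness joins one further vertex to a single vertex in each class of a balanced complete
  bipartite graph. This already gives \<open>\<rho>\<^sup>2 \<ge> F\<close>, which is all that the comparison needs.
\<close>

lemma ex_nonbipartite_free_large_radius:
  assumes n: "n \<ge> 3" and r: "r \<ge> 1"
  shows "\<exists>G\<in>nonbipartite_free n (book (r + 1)). sqrt (real (turan2 (n - 1))) \<le> graph_spectral_radius G"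
proof -
  define k where "k = n - 1"
  define p where "p = k div 2"
  have kp: "n = Suc k" "0 < p" "p < k" using n by (auto simp: k_def p_def)
  define A B where "A = {0..<p}" and "B = {p..<k}"
  define E where "E = A \<times> B \<union> {(k, 0), (k, p)}"
  define N where "N u = {v. (u, v) \<in> E \<union> E\<inverse>}" for u
  interpret simple_graph "{0..<n}" N
    using kp by unfold_locales (auto simp: N_def E_def A_def B_def)
  have bipk: "bipartition ({0..<n} - {k}) A B"
    using kp by (auto simp: bipartition_def indep_def N_def E_def A_def B_def)
  have "N k \<inter> A = {0}" "N k \<inter> B = {p}" using kp by (auto simp: N_def E_def A_def B_def)
  then have st: "N k \<inter> A \<noteq> {}" "card (N k \<inter> A) \<le> r" "N k \<inter> B \<noteq> {}" "card (N k \<inter> B) \<le> r"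
    using r by auto
  have complete: "B \<subseteq> N u" if "u \<in> A" for u using that by (auto simp: N_def E_def)
  have k: "k \<in> {0..<n}" using kp by simp
  note G = graph_of_nbhd_in_graphs_on[OF simple_graph_axioms]
  have "graph_of_nbhd n N \<in> nonbipartite_free n (book (r + 1))"
    unfolding nonbipartite_free_iff[OF G(1)] G(2)
    using complete_plus_vertex[OF k bipk complete st] by blast
  moreover have "turan2 (n - 1) = card A * card B"
    by (simp add: turan2_def A_def B_def p_def k_def)
  then have "sqrt (real (turan2 (n - 1))) \<le> graph_spectral_radius (graph_of_nbhd n N)"
    using complete_bipartite_spectral_radius[OF G(1), of k A B] k bipk complete unfolding G(2) by simp
  ultimately show ?thesis by blast
qed

section \<open>Spectral extremal graphs are edge extremal\<close>

text \<open>
  An upper bound for the number of exceptional vertices left by \<open>ex_near_bipartition\<close> for the edge deficit that the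
  crude bound \<open>2\<rho>\<^sup>2 \<le> D + rn\<close> guarantees.
\<close>

definition stability_const :: "nat \<Rightarrow> nat" where
  "stability_const r = (2 * r + 2) + r + 100 * (2 * (2 * r + 2) + 2 * r)"

text \<open>
  The sum of the lower bounds on \<open>n\<close> required by the individual steps.
\<close>

definition threshold :: "nat \<Rightarrow> nat" where
  "threshold r = 4000 * (2 * (2 * r + 2) + 2 * r) + 10 * r
     + 100 * (4 * stability_const r * r + 2 * (stability_const r)\<^sup>2 + r)
     + 1000 * (3 * r + 2 + 2 * stability_const r * r + 1)\<^sup>2 + 100 * r + 100 * stability_const r + 100"

context book_free_graph
begin

lemma ex_near_bipartition_large:
  assumes D: "2 * turan2 (card V - 1) \<le> D + r * card V" and n: "card V > threshold r"
  shows "\<exists>A B. near_bipartition (stability_const r) A B"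
proof -
  define n where "n = card V - 1"
  have n1: "card V = n + 1" using n by (simp add: n_def threshold_def)
  have "n * n \<le> 4 * turan2 n + 1" by (rule turan2_bounds)
  moreover have "(card V)\<^sup>2 = n * n + 2 * n + 1" unfolding n1 by (simp add: power2_eq_square)
  ultimately have "(card V)\<^sup>2 \<le> 2 * D + (2 * r + 2) * card V"
    using D n1 unfolding n_def[symmetric] by (simp add: algebra_simps)
  from ex_near_bipartition[OF this] n show ?thesis
    by (simp only: stability_const_def threshold_def)
qed

lemma bipartite_after_deleting_vertex_large:
  assumes D: "2 * turan2 (card V - 1) \<le> D + 2 * stability_const r * r" and nonbip: "\<nexists>P Q. bipartition V P Q"
    and n: "card V > threshold r"
  shows "\<exists>x\<in>V. \<exists>P Q. bipartition (V - {x}) P Q"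
proof -
  define n where "n = card V - 1"
  have n1: "card V = n + 1" using n by (simp add: n_def threshold_def)
  have nn: "n * n \<le> 4 * turan2 n + 1" by (rule turan2_bounds)
  have sq: "(card V)\<^sup>2 = n * n + 2 * n + 1" unfolding n1 by (simp add: power2_eq_square)
  have D2: "(card V)\<^sup>2 \<le> 2 * D + 2 * card V + 4 * stability_const r * r"
    using D n1 nn sq unfolding n_def[symmetric] by simp
  have "2 * stability_const r * r \<le> r * card V"
  proof -
    have "2 * stability_const r \<le> card V" using n by (simp add: threshold_def)
    then show ?thesis by (metis mult.commute mult_le_mono2)
  qed
  then have "2 * turan2 (card V - 1) \<le> D + r * card V" using D by linarith
  then obtain A B where "near_bipartition (stability_const r) A B"
    using ex_near_bipartition_large n by blast
  then show ?thesis
    using bipartite_after_deleting_vertex[OF _ D2 nonbip] n by (simp add: threshold_def)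
qed

lemma edges_le_large:
  assumes r: "r \<ge> 1" and nonbip: "\<nexists>P Q. bipartition V P Q" and n: "card V > threshold r"
  shows "D \<le> 2 * turan2 (card V - 1) + 4 * r"
proof (cases "2 * turan2 (card V - 1) \<le> D")
  case True
  then have "2 * turan2 (card V - 1) \<le> D + 2 * stability_const r * r" by simp
  then show ?thesis
    using bipartite_after_deleting_vertex_large[OF _ nonbip n] edges_le[OF r _ _ nonbip] by blast
qed simp

end

context perron_graph
begin

text \<open>
  Stability is used twice: the crude walk bound gives a near-bipartition, with its help the refined
  walk bound improves the edge deficit from linear to bounded, and this suffices for deleting a
  single vertex.
\<close>

lemma extremal_structure_large:
  assumes r: "r \<ge> 1" and nonbip: "\<nexists>P Q. bipartition V P Q"
    and rho: "real (turan2 (card V - 1)) \<le> \<rho>\<^sup>2" and n: "card V > threshold r"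
  shows "\<exists>x\<in>V. \<exists>A B. bipartition (V - {x}) A B \<and> missing A B = 0 \<and> card A * card B = turan2 (card V - 1)
     \<and> card (N x \<inter> A) \<le> card (N x \<inter> B) \<and> (\<forall>b\<in>B. z b > 0)"
proof -
  let ?F = "turan2 (card V - 1)"
  have "real (2 * ?F) \<le> real (D + r * card V)" using rho rho_square_le_crude by simp
  then have "2 * ?F \<le> D + r * card V" by (simp only: of_nat_le_iff)
  from ex_near_bipartition_large[OF this n]
  obtain A B where nb: "near_bipartition (stability_const r) A B" by blast
  have "real (card V) / 4 \<le> \<rho>"
  proof (rule power2_le_imp_le)
    define m where "m = card V - 2"
    have m: "card V = m + 2" using n by (simp add: m_def threshold_def)
    have m98: "m \<ge> 98" using n m by (simp add: threshold_def)
    have "(m + 1) * (m + 1) \<le> 4 * ?F + 1" using turan2_bounds(1)[of "m + 1"] m by simp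
    then have "real ((m + 1) * (m + 1)) \<le> real (4 * ?F + 1)" by (rule of_nat_mono)
    then have "real m * real m + 2 * real m \<le> 4 * \<rho>\<^sup>2" using rho by (simp add: algebra_simps)
    moreover have "16 * (real (card V) / 4)\<^sup>2 = real m * real m + 4 * real m + 4"
      unfolding m by (simp add: power2_eq_square algebra_simps)
    moreover have "0 \<le> real m * real m" "98 \<le> real m" using m98 by simp_all
    ultimately show "(real (card V) / 4)\<^sup>2 \<le> \<rho>\<^sup>2" by linarith
  qed (use rho_pos in simp)
  moreover have "real (100 * r + 100 * stability_const r) \<le> real (card V)"
    using n by (intro of_nat_mono) (simp add: threshold_def)
  moreover have "real (card V) > 0" using n by simp
  ultimately have "50 * \<rho> > 100 * real r + 2 * real (card V) + 50 * real (stability_const r)"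
    by simp
  from rho_square_le_refined[OF nb this]
  have "real (2 * ?F) \<le> real (D + 2 * stability_const r * r)" using rho by simp
  then have D: "2 * ?F \<le> D + 2 * stability_const r * r" by (simp only: of_nat_le_iff)
  have "card V > 1000 * (3 * r + 2 + 2 * stability_const r * r + 1)\<^sup>2"
    using n unfolding threshold_def by linarith
  from extremal_structure[OF r nonbip rho D bipartite_after_deleting_vertex_large[OF D nonbip n] this]
  show ?thesis .
qed

end

lemma num_edges_le:
  assumes "H \<in> nonbipartite_free n (book (r + 1))" "r \<ge> 1" "n > threshold r"
  shows "num_edges H \<le> turan2 (n - 1) + 2 * r"
proof -
  have H: "H \<in> graphs_on n" using assms(1) by (simp add: nonbipartite_free_def)
  interpret book_free_graph "{0..<n}" "nbhd H" r using assms(1) nonbipartite_free_iff[OF H] by blast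
  have "\<nexists>A B. bipartition {0..<n} A B" using assms(1) nonbipartite_free_iff[OF H] by blast
  then have "D \<le> 2 * turan2 (n - 1) + 4 * r" using edges_le_large assms(2,3) by simp
  then show ?thesis using double_num_edges[OF H] by simp
qed

lemma (in simple_graph) insert_edge_simple_graph:
  assumes "x \<in> V" "y \<in> V" "x \<noteq> y"
  shows "simple_graph V (\<lambda>u. if u = x then insert y (N x) else if u = y then insert x (N y) else N u)"
  using assms finV N_sub N_sym N_irr
  by unfold_locales (auto split: if_splits)

text \<open>
  By the structure of \<open>G\<close>, \<open>e = F + s + t\<close> with \<open>s \<le> t \<le> r\<close>. If \<open>s + t < 2r\<close>, then \<open>s < r\<close> and \<open>x\<close>
  has a non-neighbour \<open>y\<close> in \<open>A\<close>. Adding the edge \<open>xy\<close> keeps the graph book-free and non-bipartite,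
  and raises the Rayleigh quotient of the Perron vector, whose entries at \<open>x\<close> and \<open>y\<close> are positive.
\<close>

lemma num_edges_Spex3:
  assumes r: "r \<ge> 1" and n: "n > threshold r" and G: "G \<in> Spex3 n (book (r + 1))"
  shows "num_edges G = turan2 (n - 1) + 2 * r"
proof -
  define \<rho> where "\<rho> = graph_spectral_radius G"
  have Gf: "G \<in> nonbipartite_free n (book (r + 1))"
    and Gmax: "\<And>H. H \<in> nonbipartite_free n (book (r + 1)) \<Longrightarrow> graph_spectral_radius H \<le> \<rho>"
    using G by (auto simp: Spex3_def \<rho>_def)
  have Gn: "G \<in> graphs_on n" using Gf by (simp add: nonbipartite_free_def)
  have n100: "n > 100" using n by (simp add: threshold_def)
  then have n1: "n \<ge> 1" by simp
  have bf: "book_free_graph {0..<n} (nbhd G) r" and nonbip: "\<nexists>A B. simple_graph.bipartition (nbhd G) {0..<n} A B"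
    using Gf nonbipartite_free_iff[OF Gn] by blast+
  have sqrtF: "sqrt (real (turan2 (n - 1))) \<le> \<rho>"
    using ex_nonbipartite_free_large_radius[of n r] Gmax n100 r by force
  have F: "n - 1 \<le> turan2 (n - 1)"
  proof -
    have "(n - 1) * 5 \<le> (n - 1) * (n - 1)" using n100 by (intro mult_le_mono) auto
    then show ?thesis using turan2_bounds(1)[of "n - 1"] n100 by linarith
  qed
  then have "real (turan2 (n - 1)) > 0" using n100 by linarith
  then have "0 < sqrt (real (turan2 (n - 1)))" by simp
  then have rho: "\<rho> > 0" "real (turan2 (n - 1)) \<le> \<rho>\<^sup>2"
    using sqrtF by (linarith, simp add: sqrt_le_D)
  obtain z u where z: "\<And>v. z v \<ge> 0" "\<And>v. v \<in> {0..<n} \<Longrightarrow> z v \<le> 1" "u \<in> {0..<n}" "z u = 1"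
    "\<And>v. v \<in> {0..<n} \<Longrightarrow> (\<Sum>w\<in>nbhd G v. z w) = \<rho> * z v"
    using ex_perron_vector[OF Gn n1] unfolding \<rho>_def by blast
  interpret book_free_graph "{0..<n}" "nbhd G" r by fact
  interpret perron_graph "{0..<n}" "nbhd G" r z \<rho> u
    by unfold_locales (use z rho in auto)
  obtain x A B where x: "x \<in> {0..<n}" and AB: "bipartition ({0..<n} - {x}) A B" and m0: "missing A B = 0"
    and abF: "card A * card B = turan2 (n - 1)"
    and st: "card (nbhd G x \<inter> A) \<le> card (nbhd G x \<inter> B)" and zB: "\<And>b. b \<in> B \<Longrightarrow> z b > 0"
    using extremal_structure_large[OF r nonbip] rho n by auto
  note ABD = classesD[OF x AB]
  define s t where "s = card (nbhd G x \<inter> A)" and "t = card (nbhd G x \<inter> B)"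
  note ne = neighbours_in_both_classes[OF x AB nonbip]
  have "s > 0" using ne ABD by (simp add: s_def card_gt_0_iff)
  have complete: "B \<subseteq> nbhd G v" if "v \<in> A" for v
    using m0 that ABD by (auto simp: missing_def)
  have tr: "t \<le> r" using missing_lower[OF ABD(5,6), of x] m0 \<open>s > 0\<close> by (simp add: s_def t_def mult.commute)
  have "2 * num_edges G = 2 * turan2 (n - 1) + 2 * (s + t)"
    using D_deleted(1)[OF x AB] m0 abF double_num_edges[OF Gn] by (simp add: s_def t_def)
  then have e: "num_edges G = turan2 (n - 1) + (s + t)" by simp
  have "s + t = 2 * r"
  proof (rule ccontr)
    assume "s + t \<noteq> 2 * r"
    then have sr: "s < r" using st tr by (simp add: s_def t_def)
    have "r < card A"
    proof (rule ccontr)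
      assume "\<not> r < card A"
      moreover have "card B \<le> n - 1" using D_deleted(2)[OF x AB] by simp
      ultimately have "turan2 (n - 1) \<le> r * (n - 1)" unfolding abF[symmetric] by (intro mult_le_mono) auto
      then have "(n - 1) * (n - 1) \<le> 4 * (r * (n - 1)) + 1" using turan2_bounds(1)[of "n - 1"] by linarith
      also have "\<dots> \<le> 4 * (r * (n - 1)) + (n - 1)" using n100 by simp
      also have "\<dots> = (n - 1) * (4 * r + 1)" by simp
      finally have "n - 1 \<le> 4 * r + 1" using n100 unfolding mult_le_cancel1 by simp
      then show False using n by (simp add: threshold_def)
    qed
    then have "nbhd G x \<inter> A \<noteq> A" using sr unfolding s_def by auto
    then obtain y where y: "y \<in> A" "y \<notin> nbhd G x" by blast
    have yV: "y \<in> {0..<n}" "x \<noteq> y" using y ABD by auto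
    define N' where "N' v = (if v = x then insert y (nbhd G x) else if v = y then insert x (nbhd G y) else nbhd G v)" for v
    have sg: "simple_graph {0..<n} N'"
      using insert_edge_simple_graph[OF x yV] unfolding N'_def .
    interpret G': simple_graph "{0..<n}" N' by (rule sg)
    have AB': "G'.bipartition ({0..<n} - {x}) A B"
      using ABD y(1) unfolding G'.bipartition_def G'.indep_def indep_def by (auto simp: N'_def)
    have "B \<subseteq> N' v" if "v \<in> A" for v
      using complete[OF that] that ABD by (auto simp: N'_def)
    moreover have "N' x \<inter> A = insert y (nbhd G x \<inter> A)" "N' x \<inter> B = nbhd G x \<inter> B"
      using y(1) ABD by (auto simp: N'_def)
    moreover have "card (insert y (nbhd G x \<inter> A)) \<le> r"
      using sr y ABD by (simp add: s_def)
    ultimately have "book_free_graph {0..<n} N' r" "\<nexists>P Q. G'.bipartition {0..<n} P Q"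
      using G'.complete_plus_vertex[OF x AB'] ne tr by (auto simp: t_def)
    note H = graph_of_nbhd_in_graphs_on[OF sg]
    have "graph_of_nbhd n N' \<in> nonbipartite_free n (book (r + 1))"
      unfolding nonbipartite_free_iff[OF H(1)] H(2) using \<open>book_free_graph {0..<n} N' r\<close> \<open>\<nexists>P Q. G'.bipartition {0..<n} P Q\<close> by blast
    then have "graph_spectral_radius (graph_of_nbhd n N') \<le> \<rho>" by (rule Gmax)
    then have "graph_spectral_radius (graph_of_nbhd n N') * (\<Sum>i\<in>{0..<n}. (z i)\<^sup>2) \<le> \<rho> * (\<Sum>i\<in>{0..<n}. (z i)\<^sup>2)"
      by (intro mult_right_mono sum_nonneg) auto
    then have le: "(\<Sum>i\<in>{0..<n}. z i * (\<Sum>j\<in>N' i. z j)) \<le> \<rho> * (\<Sum>i\<in>{0..<n}. (z i)\<^sup>2)"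
      using rayleigh_le_graph_spectral_radius[OF H(1) n1, of z] unfolding H(2) by linarith
    have term_eq: "z i * (\<Sum>j\<in>N' i. z j) = \<rho> * (z i)\<^sup>2 + (if i = x then z x * z y else 0) + (if i = y then z x * z y else 0)"
      if "i \<in> {0..<n}" for i
    proof -
      have xy: "x \<notin> nbhd G y" using y(2) N_sym by blast
      have "(\<Sum>j\<in>N' i. z j) = (\<Sum>j\<in>nbhd G i. z j) + (if i = x then z y else 0) + (if i = y then z x else 0)"
        using yV(2) xy y(2) by (auto simp: N'_def)
      then show ?thesis using z(5)[OF that] by (simp add: algebra_simps power2_eq_square)
    qed
    have "(\<Sum>i\<in>{0..<n}. z i * (\<Sum>j\<in>N' i. z j)) = (\<Sum>i\<in>{0..<n}. \<rho> * (z i)\<^sup>2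
        + (if i = x then z x * z y else 0) + (if i = y then z x * z y else 0))"
      by (rule sum.cong[OF refl term_eq])
    also have "\<dots> = \<rho> * (\<Sum>i\<in>{0..<n}. (z i)\<^sup>2) + 2 * (z x * z y)"
      using x yV(1) by (simp add: sum.distrib flip: sum_distrib_left)
    finally have "z x * z y \<le> 0" using le by linarith
    moreover have "z v > 0" if v: "v \<in> {0..<n}" and "b \<in> B" "b \<in> nbhd G v" for v b
    proof -
      have "0 < z b" using zB that by blast
      also have "z b \<le> (\<Sum>w\<in>nbhd G v. z w)" by (rule member_le_sum) (use that z(1) in auto)
      also have "\<dots> = \<rho> * z v" by (rule z(5)[OF v])
      finally show ?thesis using rho(1) by (simp add: zero_less_mult_iff)
    qed
    moreover obtain b where "b \<in> B" "b \<in> nbhd G x" using ne(2) by blast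
    moreover from this have "b \<in> nbhd G y" using complete[OF y(1)] by blast
    ultimately have "z x > 0" "z y > 0" using x yV(1) by blast+
    then show False using \<open>z x * z y \<le> 0\<close> by (simp add: mult_le_0_iff)
  qed
  then show ?thesis using e by simp
qed

theorem corollary1p1:
  fixes r :: nat
  assumes "r \<ge> 1"
  shows "\<exists>N. \<forall>n\<ge>N. Spex3 n (book (r + 1)) \<subseteq> Ex3 n (book (r + 1))"
proof (intro exI[of _ "threshold r + 1"] allI impI subsetI)
  fix n G assume "n \<ge> threshold r + 1" and G: "G \<in> Spex3 n (book (r + 1))"
  then have n: "n > threshold r" by simp
  let ?\<F> = "nonbipartite_free n (book (r + 1))"
  have Gf: "G \<in> ?\<F>" using G by (simp add: Spex3_def)
  have le: "num_edges H \<le> num_edges G" if "H \<in> ?\<F>" for H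
    using num_edges_le[OF that assms n] num_edges_Spex3[OF assms n G] by simp
  have "finite (num_edges ` ?\<F>)"
    by (rule finite_subset[of _ "{..num_edges G}"]) (use le in auto)
  then have "ex3 n (book (r + 1)) = num_edges G"
    unfolding ex3_def using Gf le by (intro Max_eqI) auto
  then show "G \<in> Ex3 n (book (r + 1))" using Gf by (simp add: Ex3_def)
qed

end
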